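(* Let $(T,+)$ be a Hausdorff semitopological semigroup, let $S$ be a dense subsemigroup of $(T,+)$, let $e\in E(T)$ be an idempotent of $T$, and let $B\subseteq S$. Then $B$ is central near $e$ if and only if there exist a dynamical system $(X,\langle T_s\rangle_{s\in S})$, points $x,y\in X$ and a neighbourhood $U$ of $y$ such that $x$ and $y$ are proximal near $e$, $y$ is uniformly recurrent near $e$, and $B=\{s\in S: T_s(x)\in U\}$.
   Context: A semitopological semigroup is a semigroup (written additively, not assumed commutative) with a topology for which all left and right translations are continuous. $E(T)$ is the set of idempotents of $T$, and $\tau_e$ is the collection of all neighbourhoods of $e$ in $T$. $P_f(Y)$ denotes the set of finite nonempty subsets of $Y$. For $t\in S$ and $A\subseteq S$, $-t+A=\{s\in S: t+s\in A\}$. $\beta S$ ($=\beta S_d$) is the Stone-Čech compactification of $S$ with the discrete topology, i.e. the set of ultrafilters on $S$, with basic clopen sets $\bar A=\{p\in\beta S: A\in p\}$, $A\subseteq S$. The operation is extended to $\beta S$ by: $A\in p+q$ iff $\{s\in S: -s+A\in q\}\in p$; this makes $\beta S$ a compact right topological semigroup (each map $q\mapsto q+p$ is continuous). Put $e^*_S=\{p\in\beta S: e\in\bigcap_{A\in p}cl_T(A)\}$, which is a compact right topological subsemigroup of $\beta S$, and let $K=K(e^*_S)$ be its smallest two-sided ideal. A set $A\subseteq S$ is central near $e$ iff there is an idempotent $p\in K(e^*_S)$ with $A\in p$. A dynamical system $(X,\langle T_s\rangle_{s\in S})$ consists of a compact Hausdorff space $X$ and continuous maps $T_s:X\to X$ ($s\in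 S$) with $T_s\circ T_t=T_{s+t}$ for all $s,t\in S$. A set $B\subseteq S$ is syndetic near $e$ iff for each $U\in\tau_e$ there exist $F\in P_f(U\cap S)$ and $V\in\tau_e$ such that $S\cap V\subseteq\bigcup_{t\in F}(-t+B)$. A point $x\in X$ is uniformly recurrent near $e$ iff for each neighbourhood $W$ of $x$, $\{s\in S: T_s(x)\in W\}$ is syndetic near $e$. Points $x,y\in X$ are proximal near $e$ iff for every neighbourhood $U$ of the diagonal in $X\times X$ and each $V\in\tau_e$ there exists $s\in S\cap V$ with $(T_s(x),T_s(y))\in U$. *)

theory Defs
  imports "HOL-Analysis.Analysis"
begin

(* Continuity is required of each translation separately; no commutativity and no joint
   continuity of the addition. *)
class semitopological_semigroup_add = semigroup_add + topological_space +
  assumes tendsto_left_translation: "LIM x nhds b. a + x :> nhds (a + b)"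
    and tendsto_right_translation: "LIM x nhds b. x + a :> nhds (b + a)"

lemma continuous_on_translations:
  fixes a :: "'a::semitopological_semigroup_add"
  shows "continuous_on UNIV (\<lambda>x. a + x)" and "continuous_on UNIV (\<lambda>x. x + a)"
proof -
  have le: "at b within UNIV \<le> nhds b" for b :: 'a
    by (simp add: at_within_def)
  show "continuous_on UNIV (\<lambda>x. a + x)"
    unfolding continuous_on_def by (blast intro: tendsto_mono[OF le] tendsto_left_translation)
  show "continuous_on UNIV (\<lambda>x. x + a)"
    unfolding continuous_on_def by (blast intro: tendsto_mono[OF le] tendsto_right_translation)
qed

definition dense_subsemigroup :: "'a::semitopological_semigroup_add set \<Rightarrow> bool" where
  "dense_subsemigroup S \<longleftrightarrow> (\<forall>s\<in>S. \<forall>t\<in>S. s + t \<in> S) \<and> closure S = UNIV"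

(* Neighbourhoods need not be open. For a point x take A = {x}. *)
definition nbhds_of :: "'x topology \<Rightarrow> 'x set \<Rightarrow> 'x set set" where
  "nbhds_of X A = {U. U \<subseteq> topspace X \<and> A \<subseteq> X interior_of U}"

abbreviation nbhds_pt :: "'a::topological_space \<Rightarrow> 'a set set" where
  "nbhds_pt e \<equiv> nbhds_of euclidean {e}"

definition translate_inv :: "'a::plus set \<Rightarrow> 'a \<Rightarrow> 'a set \<Rightarrow> 'a set" where
  "translate_inv S t A = {s\<in>S. t + s \<in> A}"


definition ultrafilter_on :: "'a set \<Rightarrow> 'a set set \<Rightarrow> bool" where
  "ultrafilter_on S p \<longleftrightarrow>
     p \<subseteq> Pow S \<and> S \<in> p \<and> {} \<notin> p \<and>
     (\<forall>A\<in>p. \<forall>B\<in>p. A \<inter> B \<in> p) \<and>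
     (\<forall>A\<in>p. \<forall>B. A \<subseteq> B \<and> B \<subseteq> S \<longrightarrow> B \<in> p) \<and>
     (\<forall>A. A \<subseteq> S \<longrightarrow> A \<in> p \<or> S - A \<in> p)"

(* The underlying set of the Stone-Cech compactification of the discrete space S. *)
definition stone_cech :: "'a set \<Rightarrow> 'a set set set" where
  "stone_cech S = {p. ultrafilter_on S p}"

definition uplus :: "'a::plus set \<Rightarrow> 'a set set \<Rightarrow> 'a set set \<Rightarrow> 'a set set" where
  "uplus S p q = {A. A \<subseteq> S \<and> {s\<in>S. translate_inv S s A \<in> q} \<in> p}"

definition ultrafilters_near :: "'a::topological_space set \<Rightarrow> 'a \<Rightarrow> 'a set set set" where
  "ultrafilters_near S e = {p \<in> stone_cech S. e \<in> (\<Inter>A\<in>p. closure A)}"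

definition two_sided_ideal :: "('c \<Rightarrow> 'c \<Rightarrow> 'c) \<Rightarrow> 'c set \<Rightarrow> 'c set \<Rightarrow> bool" where
  "two_sided_ideal f C I \<longleftrightarrow>
     I \<noteq> {} \<and> I \<subseteq> C \<and> (\<forall>c\<in>C. \<forall>i\<in>I. f c i \<in> I \<and> f i c \<in> I)"

(* Least element with respect to inclusion. *)
definition smallest_ideal :: "('c \<Rightarrow> 'c \<Rightarrow> 'c) \<Rightarrow> 'c set \<Rightarrow> 'c set" where
  "smallest_ideal f C = (LEAST I. two_sided_ideal f C I)"

definition central_near :: "'a::semitopological_semigroup_add set \<Rightarrow> 'a \<Rightarrow> 'a set \<Rightarrow> bool" where
  "central_near S e A \<longleftrightarrow>
     (\<exists>p \<in> smallest_ideal (uplus S) (ultrafilters_near S e). uplus S p p = p \<and> A \<in> p)"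


definition dynamical_system ::
    "'a::plus set \<Rightarrow> 'x topology \<Rightarrow> ('a \<Rightarrow> 'x \<Rightarrow> 'x) \<Rightarrow> bool" where
  "dynamical_system S X act \<longleftrightarrow>
     compact_space X \<and> Hausdorff_space X \<and>
     (\<forall>s\<in>S. continuous_map X X (act s)) \<and>
     (\<forall>s\<in>S. \<forall>t\<in>S. \<forall>x\<in>topspace X. act s (act t x) = act (s + t) x)"

definition syndetic_near ::
    "'a::semitopological_semigroup_add set \<Rightarrow> 'a \<Rightarrow> 'a set \<Rightarrow> bool" where
  "syndetic_near S e B \<longleftrightarrow>
     (\<forall>U\<in>nbhds_pt e. \<exists>F. finite F \<and> F \<noteq> {} \<and> F \<subseteq> U \<inter> S \<and>
        (\<exists>V\<in>nbhds_pt e. S \<inter> V \<subseteq> (\<Union>t\<in>F. translate_inv S t B)))"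

definition uniformly_recurrent_near ::
    "'a::semitopological_semigroup_add set \<Rightarrow> 'a \<Rightarrow> 'x topology \<Rightarrow> ('a \<Rightarrow> 'x \<Rightarrow> 'x) \<Rightarrow> 'x \<Rightarrow> bool" where
  "uniformly_recurrent_near S e X act x \<longleftrightarrow>
     (\<forall>W\<in>nbhds_of X {x}. syndetic_near S e {s\<in>S. act s x \<in> W})"

definition proximal_near ::
    "'a::semitopological_semigroup_add set \<Rightarrow> 'a \<Rightarrow> 'x topology \<Rightarrow> ('a \<Rightarrow> 'x \<Rightarrow> 'x)
       \<Rightarrow> 'x \<Rightarrow> 'x \<Rightarrow> bool" where
  "proximal_near S e X act x y \<longleftrightarrow>
     (\<forall>U\<in>nbhds_of (prod_topology X X) {(z, z) | z. z \<in> topspace X}.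
        \<forall>V\<in>nbhds_pt e. \<exists>s\<in>S \<inter> V. (act s x, act s y) \<in> U)"

end

theory Submission
  imports Defs
begin

text \<open>Every ultrafilter \<open>p\<close> on \<open>S\<close> acts on a dynamical system: \<open>T_p x\<close> is the limit of \<open>T_s x\<close> along
  \<open>p\<close>. The definition of \<open>p + q\<close> is made so that \<open>T_p (T_q x) = T_(p+q) x\<close>
  (lemma \<open>orbit_limit_uplus\<close>). Both dynamical notions translate into this language, with all
  ultrafilters taken near \<open>e\<close>:

  \<^item> \<open>x\<close> and \<open>y\<close> are proximal near \<open>e\<close> iff \<open>T_p x = T_p y\<close> for some \<open>p\<close>
    (\<open>proximal_near_imp_common_limit\<close>, \<open>common_limit_imp_proximal_near\<close>);
  \<^item> \<open>y\<close> is uniformly recurrent near \<open>e\<close> iff for each \<open>q\<close> there is an \<open>r\<close> with \<open>T_r (T_q y) = y\<close>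
    (\<open>uniformly_recurrent_near_imp_return\<close>, \<open>return_imp_uniformly_recurrent_near\<close>).

  The theorem then becomes algebra in the compact right topological semigroup of ultrafilters near
  \<open>e\<close>, whose smallest ideal is the union of its minimal left ideals. Given \<open>x\<close>, \<open>y\<close> and \<open>U\<close>, the \<open>p\<close>
  with \<open>T_p x = T_p y\<close> form a left ideal; a minimal left ideal inside it contains, by recurrence and
  Ellis's lemma, an idempotent \<open>p\<close> with \<open>T_p y = y\<close>, and then \<open>T_p x = y\<close> says that the set of visits
  of \<open>x\<close> to \<open>U\<close> belongs to \<open>p\<close>. Conversely, let \<open>p\<close> be an idempotent in a minimal left ideal with
  \<open>B \<in> p\<close>. In the full shift over the semigroup with an identity adjoined, take for \<open>x\<close> the indicator
  function of \<open>B\<close> and \<open>y = T_p x\<close>. Then \<open>T_p y = y\<close> because \<open>p + p = p\<close>, and \<open>y\<close> is uniformly recurrent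
  because every \<open>q + p\<close> can be brought back to \<open>p\<close> by some \<open>r\<close> on the left.\<close>

section \<open>Ultrafilters\<close>

lemma ultrafilter_onD:
  assumes "ultrafilter_on S p"
  shows "p \<subseteq> Pow S" "S \<in> p" "{} \<notin> p"
    "\<And>A B. A \<in> p \<Longrightarrow> B \<in> p \<Longrightarrow> A \<inter> B \<in> p"
    "\<And>A B. A \<in> p \<Longrightarrow> A \<subseteq> B \<Longrightarrow> B \<subseteq> S \<Longrightarrow> B \<in> p"
    "\<And>A. A \<subseteq> S \<Longrightarrow> S - A \<in> p \<longleftrightarrow> A \<notin> p"
proof -
  note u = assms[unfolded ultrafilter_on_def]
  show "p \<subseteq> Pow S" "S \<in> p" "{} \<notin> p"
    "\<And>A B. A \<in> p \<Longrightarrow> B \<in> p \<Longrightarrow> A \<inter> B \<in> p"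
    "\<And>A B. A \<in> p \<Longrightarrow> A \<subseteq> B \<Longrightarrow> B \<subseteq> S \<Longrightarrow> B \<in> p"
    using u by blast+
  show "S - A \<in> p \<longleftrightarrow> A \<notin> p" if "A \<subseteq> S" for A
  proof -
    have "A \<inter> (S - A) = {}" by blast
    then show ?thesis using u that by metis
  qed
qed

lemma ultrafilter_on_subset: "ultrafilter_on S p \<Longrightarrow> A \<in> p \<Longrightarrow> A \<subseteq> S"
  by (auto dest: ultrafilter_onD(1))

lemma ultrafilter_on_eqI:
  assumes "ultrafilter_on S p" "ultrafilter_on S q" "p \<subseteq> q"
  shows "p = q"
proof (rule antisym)
  show "q \<subseteq> p"
  proof
    fix A assume A: "A \<in> q"
    then have AS: "A \<subseteq> S" by (rule ultrafilter_on_subset[OF assms(2)])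
    then have "S - A \<notin> p" using A assms(3) ultrafilter_onD(6)[OF assms(2) AS] by blast
    then show "A \<in> p" using ultrafilter_onD(6)[OF assms(1) AS] by simp
  qed
qed (rule assms(3))

lemma ultrafilter_on_finite_Union:
  assumes "ultrafilter_on S p" "finite F" "\<And>i. i \<in> F \<Longrightarrow> A i \<subseteq> S" "(\<Union>i\<in>F. A i) \<in> p"
  shows "\<exists>i\<in>F. A i \<in> p"
  using assms(2-4)
proof (induction F)
  case empty
  then show ?case using ultrafilter_onD(3)[OF assms(1)] by simp
next
  case (insert i F)
  show ?case
  proof (cases "A i \<in> p")
    case False
    then have "S - A i \<in> p" using ultrafilter_onD(6)[OF assms(1)] insert.prems by simp
    then have "(S - A i) \<inter> (\<Union>i\<in>insert i F. A i) \<in> p"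
      using ultrafilter_onD(4)[OF assms(1)] insert.prems by blast
    moreover have "(S - A i) \<inter> (\<Union>i\<in>insert i F. A i) \<subseteq> (\<Union>i\<in>F. A i)" by blast
    moreover have "(\<Union>i\<in>F. A i) \<subseteq> S" using insert.prems by blast
    ultimately have "(\<Union>i\<in>F. A i) \<in> p" by (rule ultrafilter_onD(5)[OF assms(1)])
    then show ?thesis using insert.IH insert.prems by simp
  qed simp
qed

definition finite_intersections_on :: "'a set \<Rightarrow> 'a set set \<Rightarrow> bool" where
  "finite_intersections_on S \<A> \<longleftrightarrow> (\<forall>F. finite F \<and> F \<subseteq> \<A> \<longrightarrow> S \<inter> \<Inter>F \<noteq> {})"

text \<open>A family that is maximal for the finite intersection property contains every set that meets
  all its finite intersections, and this makes it an ultrafilter.\<close>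

lemma ultrafilter_extending:
  assumes "\<A> \<subseteq> Pow S" "finite_intersections_on S \<A>"
  shows "\<exists>p. ultrafilter_on S p \<and> \<A> \<subseteq> p"
proof -
  define Z where "Z = {\<B>. \<A> \<subseteq> \<B> \<and> \<B> \<subseteq> Pow S \<and> finite_intersections_on S \<B>}"
  have "\<exists>M\<in>Z. \<forall>X\<in>Z. M \<subseteq> X \<longrightarrow> X = M"
  proof (rule subset_Zorn_nonempty)
    show "Z \<noteq> {}" using assms by (auto simp: Z_def)
    fix \<C> assume \<C>: "\<C> \<noteq> {}" "subset.chain Z \<C>"
    then have sub: "\<C> \<subseteq> Z" by (simp add: subset_chain_def)
    have "finite_intersections_on S (\<Union>\<C>)"
      unfolding finite_intersections_on_def
    proof (intro allI impI)
      fix F assume F: "finite F \<and> F \<subseteq> \<Union>\<C>"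
      then obtain C where "C \<in> \<C>" "F \<subseteq> C"
        using finite_subset_Union_chain[of F \<C> Z] \<C> by blast
      then show "S \<inter> \<Inter>F \<noteq> {}"
        using F sub by (auto simp: Z_def finite_intersections_on_def)
    qed
    moreover have "\<A> \<subseteq> \<Union>\<C>" "\<Union>\<C> \<subseteq> Pow S" using \<C>(1) sub unfolding Z_def by blast+
    ultimately show "\<Union>\<C> \<in> Z" by (simp add: Z_def)
  qed
  then obtain M where M: "M \<in> Z" and max: "\<And>X. X \<in> Z \<Longrightarrow> M \<subseteq> X \<Longrightarrow> X = M" by blast
  have MS: "M \<subseteq> Pow S" and fip: "\<And>F. finite F \<Longrightarrow> F \<subseteq> M \<Longrightarrow> S \<inter> \<Inter>F \<noteq> {}"
    using M by (auto simp: Z_def finite_intersections_on_def)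
  have mem: "A \<in> M" if A: "A \<subseteq> S" and meets: "\<And>F. finite F \<Longrightarrow> F \<subseteq> M \<Longrightarrow> A \<inter> \<Inter>F \<noteq> {}" for A
  proof -
    have "finite_intersections_on S (insert A M)"
      unfolding finite_intersections_on_def
    proof (intro allI impI)
      fix F assume F: "finite F \<and> F \<subseteq> insert A M"
      then have "A \<inter> \<Inter>(F - {A}) \<noteq> {}" by (intro meets) auto
      moreover have "A \<inter> \<Inter>(F - {A}) \<subseteq> S \<inter> \<Inter>F" using A by blast
      ultimately show "S \<inter> \<Inter>F \<noteq> {}" by blast
    qed
    then have "insert A M \<in> Z" using M A by (auto simp: Z_def)
    then show ?thesis using max[of "insert A M"] by blast
  qed
  have up: "B \<in> M" if "A \<in> M" "A \<subseteq> B" "B \<subseteq> S" for A B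
  proof (rule mem)
    fix F assume F: "finite F" "F \<subseteq> M"
    then have "S \<inter> \<Inter>(insert A F) \<noteq> {}" using that by (intro fip) auto
    then show "B \<inter> \<Inter>F \<noteq> {}" using that by auto
  qed (use that in auto)
  have "ultrafilter_on S M"
    unfolding ultrafilter_on_def
  proof (intro conjI ballI allI impI)
    show "S \<in> M" using fip by (intro mem) auto
    show "{} \<notin> M" using fip[of "{{}}"] by auto
    show "A \<inter> B \<in> M" if "A \<in> M" "B \<in> M" for A B
    proof (rule mem)
      fix F assume F: "finite F" "F \<subseteq> M"
      then have "S \<inter> \<Inter>(insert A (insert B F)) \<noteq> {}" using that by (intro fip) auto
      then show "A \<inter> B \<inter> \<Inter>F \<noteq> {}" by auto
    qed (use that MS in auto)
    show "A \<in> M \<or> S - A \<in> M" if A: "A \<subseteq> S" for A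
    proof (rule disjCI)
      assume "S - A \<notin> M"
      then obtain G where G: "finite G" "G \<subseteq> M" "(S - A) \<inter> \<Inter>G = {}"
        using mem[of "S - A"] by blast
      show "A \<in> M"
      proof (rule mem[OF A])
        fix F assume F: "finite F" "F \<subseteq> M"
        then have "S \<inter> \<Inter>(F \<union> G) \<noteq> {}" using G by (intro fip) auto
        then show "A \<inter> \<Inter>F \<noteq> {}" using G(3) by auto
      qed
    qed
  qed (use MS up in blast)+
  then show ?thesis using M by (auto simp: Z_def)
qed

text \<open>An ultrafilter accumulates at \<open>e\<close> exactly when it converges to \<open>e\<close>: it contains either
  \<open>S \<inter> V\<close> or its complement, and the complement does not accumulate at \<open>e\<close>.\<close>

lemma ultrafilters_near_iff:
  "p \<in> ultrafilters_near S e \<longleftrightarrow>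
     ultrafilter_on S p \<and> (\<forall>V. open V \<and> e \<in> V \<longrightarrow> S \<inter> V \<in> p)"
proof (intro iffI conjI allI impI)
  assume p: "p \<in> ultrafilters_near S e"
  then show u: "ultrafilter_on S p" by (simp add: ultrafilters_near_def stone_cech_def)
  fix V assume V: "open V \<and> e \<in> V"
  show "S \<inter> V \<in> p"
  proof (rule ccontr)
    assume "S \<inter> V \<notin> p"
    then have "S - (S \<inter> V) \<in> p" using ultrafilter_onD(6)[OF u] by blast
    then have "e \<in> closure (S - (S \<inter> V))" using p by (auto simp: ultrafilters_near_def)
    then show False using V by (auto simp: closure_iff_nhds_not_empty)
  qed
next
  assume p: "ultrafilter_on S p \<and> (\<forall>V. open V \<and> e \<in> V \<longrightarrow> S \<inter> V \<in> p)"
  have "e \<in> closure A" if A: "A \<in> p" for A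
  proof -
    have "A \<inter> V \<noteq> {}" if "open V" "e \<in> V" for V
    proof -
      have "A \<inter> (S \<inter> V) \<in> p" using p A that ultrafilter_onD(4) by blast
      then show ?thesis using p ultrafilter_onD(3) by (metis Int_assoc Int_commute Int_empty_right)
    qed
    then show ?thesis unfolding closure_iff_nhds_not_empty by blast
  qed
  then show "p \<in> ultrafilters_near S e" using p by (simp add: ultrafilters_near_def stone_cech_def)
qed

lemma ultrafilters_near_nbhd:
  assumes "p \<in> ultrafilters_near S e" "V \<in> nbhds_pt e"
  shows "S \<inter> V \<in> p"
proof -
  have u: "ultrafilter_on S p" using assms(1) by (simp add: ultrafilters_near_iff)
  have "S \<inter> interior V \<in> p"
    using assms by (auto simp: ultrafilters_near_iff nbhds_of_def)
  then show ?thesis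
    by (rule ultrafilter_onD(5)[OF u]) (use interior_subset in auto)
qed

text \<open>This is how compactness of the set of ultrafilters near \<open>e\<close> enters the dynamical arguments:
  the sets of a filter base that accumulates at \<open>e\<close>, together with the neighbourhoods of \<open>e\<close>, have
  the finite intersection property.\<close>

lemma ultrafilter_near_extending:
  assumes "\<D> \<noteq> {}" "\<D> \<subseteq> Pow S"
    and dir: "\<And>A B. A \<in> \<D> \<Longrightarrow> B \<in> \<D> \<Longrightarrow> \<exists>C\<in>\<D>. C \<subseteq> A \<inter> B"
    and near: "\<And>A. A \<in> \<D> \<Longrightarrow> e \<in> closure A"
  shows "\<exists>p\<in>ultrafilters_near S e. \<D> \<subseteq> p"
proof -
  define \<V> where "\<V> = {S \<inter> V | V. open V \<and> e \<in> V}"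
  have lower: "\<exists>D\<in>\<D>. \<exists>V. open V \<and> e \<in> V \<and> D \<inter> V \<subseteq> \<Inter>F" if "finite F" "F \<subseteq> \<D> \<union> \<V>" for F
    using that
  proof (induction F)
    case empty
    then show ?case using assms(1) by blast
  next
    case (insert A F)
    then obtain D V where DV: "D \<in> \<D>" "open V" "e \<in> V" "D \<inter> V \<subseteq> \<Inter>F" by auto
    consider "A \<in> \<D>" | W where "A = S \<inter> W" "open W" "e \<in> W"
      using insert.prems by (auto simp: \<V>_def)
    then show ?case
    proof cases
      case 1
      then obtain C where "C \<in> \<D>" "C \<subseteq> A \<inter> D" using dir DV(1) by blast
      then show ?thesis using DV by (intro bexI[of _ C] exI[of _ V]) auto
    next
      case 2
      have "D \<subseteq> S" using DV(1) assms(2) by blast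
      then show ?thesis using DV 2 by (intro bexI[of _ D] exI[of _ "V \<inter> W"]) auto
    qed
  qed
  have "finite_intersections_on S (\<D> \<union> \<V>)"
    unfolding finite_intersections_on_def
  proof (intro allI impI)
    fix F assume "finite F \<and> F \<subseteq> \<D> \<union> \<V>"
    then obtain D V where DV: "D \<in> \<D>" "open V" "e \<in> V" "D \<inter> V \<subseteq> \<Inter>F"
      using lower[of F] by auto
    have "D \<inter> V \<noteq> {}" using near[OF DV(1)] DV(2,3) open_Int_closure_eq_empty[of V D] by blast
    then show "S \<inter> \<Inter>F \<noteq> {}" using DV assms(2) by blast
  qed
  moreover have "\<D> \<union> \<V> \<subseteq> Pow S" using assms(2) by (auto simp: \<V>_def)
  ultimately obtain p where p: "ultrafilter_on S p" "\<D> \<union> \<V> \<subseteq> p"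
    using ultrafilter_extending[of "\<D> \<union> \<V>" S] by auto
  have "p \<in> ultrafilters_near S e"
    using p by (auto simp: ultrafilters_near_iff \<V>_def)
  then show ?thesis using p(2) by auto
qed

section \<open>The Stone-Cech compactification as a compact right topological semigroup\<close>

definition stone_cech_topology :: "'a set \<Rightarrow> 'a set set topology" where
  "stone_cech_topology S = topology (\<lambda>U. U \<subseteq> stone_cech S \<and>
     (\<forall>p\<in>U. \<exists>A\<in>p. {q \<in> stone_cech S. A \<in> q} \<subseteq> U))"

lemma openin_stone_cech_topology:
  "openin (stone_cech_topology S) U \<longleftrightarrow>
     U \<subseteq> stone_cech S \<and> (\<forall>p\<in>U. \<exists>A\<in>p. {q \<in> stone_cech S. A \<in> q} \<subseteq> U)"
proof -
  have "istopology (\<lambda>U. U \<subseteq> stone_cech S \<and>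
     (\<forall>p\<in>U. \<exists>A\<in>p. {q \<in> stone_cech S. A \<in> q} \<subseteq> U))"
    unfolding istopology_def
  proof (intro conjI allI impI ballI)
    fix U V p
    assume U: "U \<subseteq> stone_cech S \<and> (\<forall>p\<in>U. \<exists>A\<in>p. {q \<in> stone_cech S. A \<in> q} \<subseteq> U)"
      and V: "V \<subseteq> stone_cech S \<and> (\<forall>p\<in>V. \<exists>A\<in>p. {q \<in> stone_cech S. A \<in> q} \<subseteq> V)"
    show "U \<inter> V \<subseteq> stone_cech S" using U by blast
    assume p: "p \<in> U \<inter> V"
    then have "\<exists>A\<in>p. {q \<in> stone_cech S. A \<in> q} \<subseteq> U" "\<exists>B\<in>p. {q \<in> stone_cech S. B \<in> q} \<subseteq> V"
      using U V by simp_all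
    then obtain A B where AB: "A \<in> p" "B \<in> p" "{q \<in> stone_cech S. A \<in> q} \<subseteq> U"
      "{q \<in> stone_cech S. B \<in> q} \<subseteq> V" by (elim bexE)
    have u: "ultrafilter_on S p" using p U by (auto simp: stone_cech_def)
    have "{q \<in> stone_cech S. A \<inter> B \<in> q} \<subseteq> U \<inter> V"
    proof
      fix q assume q: "q \<in> {q \<in> stone_cech S. A \<inter> B \<in> q}"
      then have "ultrafilter_on S q" "A \<inter> B \<in> q" by (auto simp: stone_cech_def)
      then have "A \<in> q" "B \<in> q"
        using ultrafilter_onD(5)[of S q "A \<inter> B"] ultrafilter_on_subset[OF u] AB(1,2) by auto
      then show "q \<in> U \<inter> V" using q AB by blast
    qed
    then show "\<exists>A\<in>p. {q \<in> stone_cech S. A \<in> q} \<subseteq> U \<inter> V"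
      using ultrafilter_onD(4)[OF u AB(1,2)] by (rule bexI)
  next
    fix \<K> p
    assume K: "\<forall>U\<in>\<K>. U \<subseteq> stone_cech S \<and> (\<forall>p\<in>U. \<exists>A\<in>p. {q \<in> stone_cech S. A \<in> q} \<subseteq> U)"
    then show "\<Union>\<K> \<subseteq> stone_cech S" by auto
    assume "p \<in> \<Union>\<K>"
    then obtain U where U: "U \<in> \<K>" "p \<in> U" by auto
    then obtain A where "A \<in> p" "{q \<in> stone_cech S. A \<in> q} \<subseteq> U" using K by meson
    then show "\<exists>A\<in>p. {q \<in> stone_cech S. A \<in> q} \<subseteq> \<Union>\<K>" using U(1) by (meson Union_upper order_trans)
  qed
  then show ?thesis by (simp add: stone_cech_topology_def topology_inverse')
qed

lemma openin_basic: "A \<subseteq> S \<Longrightarrow> openin (stone_cech_topology S) {p \<in> stone_cech S. A \<in> p}"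
  by (auto simp: openin_stone_cech_topology)

lemma topspace_stone_cech_topology [simp]: "topspace (stone_cech_topology S) = stone_cech S"
proof (rule antisym)
  show "topspace (stone_cech_topology S) \<subseteq> stone_cech S"
    using openin_topspace openin_stone_cech_topology by blast
  have "openin (stone_cech_topology S) (stone_cech S)"
    by (auto simp: openin_stone_cech_topology stone_cech_def dest: ultrafilter_onD(2))
  then show "stone_cech S \<subseteq> topspace (stone_cech_topology S)" by (rule openin_subset)
qed

lemma closedin_basic:
  assumes "A \<subseteq> S"
  shows "closedin (stone_cech_topology S) {p \<in> stone_cech S. A \<in> p}"
proof -
  have "stone_cech S - {p \<in> stone_cech S. A \<in> p} = {p \<in> stone_cech S. S - A \<in> p}"
    using assms ultrafilter_onD(6) by (auto simp: stone_cech_def)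
  then show ?thesis using openin_basic[of "S - A" S] by (simp add: closedin_def)
qed

text \<open>If an open cover has no finite subcover, then the complements of the basic sets that refine it
  have the finite intersection property, and an ultrafilter that extends them is not covered.\<close>

lemma compact_space_stone_cech: "compact_space (stone_cech_topology S)"
  unfolding compact_space_alt
proof (intro allI impI)
  fix \<U> assume \<U>: "(\<forall>U\<in>\<U>. openin (stone_cech_topology S) U) \<and> topspace (stone_cech_topology S) \<subseteq> \<Union>\<U>"
  show "\<exists>\<F>. finite \<F> \<and> \<F> \<subseteq> \<U> \<and> topspace (stone_cech_topology S) \<subseteq> \<Union>\<F>"
  proof (rule ccontr)
    assume no: "\<not> ?thesis"
    define \<A> where "\<A> = {S - A | A. A \<subseteq> S \<and> (\<exists>U\<in>\<U>. {p \<in> stone_cech S. A \<in> p} \<subseteq> U)}"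
    have "finite_intersections_on S \<A>"
      unfolding finite_intersections_on_def
    proof (intro allI impI notI)
      fix F assume F: "finite F \<and> F \<subseteq> \<A>" and empty: "S \<inter> \<Inter>F = {}"
      have "\<forall>B\<in>F. \<exists>U\<in>\<U>. {p \<in> stone_cech S. S - B \<in> p} \<subseteq> U"
    proof
      fix B assume "B \<in> F"
      then obtain A where "B = S - A" "A \<subseteq> S" "\<exists>U\<in>\<U>. {p \<in> stone_cech S. A \<in> p} \<subseteq> U"
        using F unfolding \<A>_def by blast
      then show "\<exists>U\<in>\<U>. {p \<in> stone_cech S. S - B \<in> p} \<subseteq> U" by (simp add: double_diff)
    qed
      then obtain u where u: "\<And>B. B \<in> F \<Longrightarrow> u B \<in> \<U> \<and> {p \<in> stone_cech S. S - B \<in> p} \<subseteq> u B"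
        by metis
      have "stone_cech S \<subseteq> \<Union>(u ` F)"
      proof
        fix p assume p: "p \<in> stone_cech S"
        then have up: "ultrafilter_on S p" by (simp add: stone_cech_def)
        have "(\<Union>B\<in>F. S - B) = S" using empty by blast
        then have "\<exists>B\<in>F. S - B \<in> p"
          using F ultrafilter_on_finite_Union[OF up, of F "\<lambda>B. S - B"] ultrafilter_onD(2)[OF up]
          by auto
        then show "p \<in> \<Union>(u ` F)" using u p by blast
      qed
      moreover have "finite (u ` F)" "u ` F \<subseteq> \<U>" using F u by auto
      ultimately show False using no by auto
    qed
    moreover have "\<A> \<subseteq> Pow S" by (auto simp: \<A>_def)
    ultimately obtain p where p: "ultrafilter_on S p" "\<A> \<subseteq> p"
      using ultrafilter_extending[of \<A> S] by auto
    then have "p \<in> stone_cech S" by (simp add: stone_cech_def)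
    then obtain U where U: "U \<in> \<U>" "p \<in> U" using \<U> by auto
    then have "openin (stone_cech_topology S) U" using \<U> by blast
    then have "\<exists>A\<in>p. {q \<in> stone_cech S. A \<in> q} \<subseteq> U"
      using U(2) unfolding openin_stone_cech_topology by meson
    then obtain A where A: "A \<in> p" "{q \<in> stone_cech S. A \<in> q} \<subseteq> U" by (elim bexE)
    have "A \<subseteq> S" using ultrafilter_on_subset[OF p(1) A(1)] .
    then have "S - A \<in> \<A>" using A U by (auto simp: \<A>_def)
    then have "S - A \<in> p" using p(2) by blast
    then show False using A(1) \<open>A \<subseteq> S\<close> ultrafilter_onD(6)[OF p(1)] by simp
  qed
qed

lemma Hausdorff_space_stone_cech: "Hausdorff_space (stone_cech_topology S)"
  unfolding Hausdorff_space_def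
proof (intro allI impI)
  fix p q assume pq: "p \<in> topspace (stone_cech_topology S) \<and> q \<in> topspace (stone_cech_topology S) \<and> p \<noteq> q"
  then have u: "ultrafilter_on S p" "ultrafilter_on S q" by (auto simp: stone_cech_def)
  then obtain A where A: "A \<in> p" "A \<notin> q" using pq ultrafilter_on_eqI[OF u] by blast
  have "A \<subseteq> S" using A(1) ultrafilter_on_subset[OF u(1)] by simp
  then have "S - A \<in> q" using ultrafilter_onD(6)[OF u(2)] A by blast
  moreover have "disjnt {r \<in> stone_cech S. A \<in> r} {r \<in> stone_cech S. S - A \<in> r}"
    using \<open>A \<subseteq> S\<close> ultrafilter_onD(6) by (auto simp: disjnt_def stone_cech_def)
  ultimately show "\<exists>U V. openin (stone_cech_topology S) U \<and> openin (stone_cech_topology S) V \<and>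
      p \<in> U \<and> q \<in> V \<and> disjnt U V"
    using openin_basic[OF \<open>A \<subseteq> S\<close>] openin_basic[of "S - A" S] A pq
    by (intro exI[of _ "{r \<in> stone_cech S. A \<in> r}"] exI[of _ "{r \<in> stone_cech S. S - A \<in> r}"]) auto
qed

lemma translate_inv_subset: "translate_inv S s A \<subseteq> S"
  by (auto simp: translate_inv_def)

lemma mem_uplus_iff:
  "A \<in> uplus S p q \<longleftrightarrow> A \<subseteq> S \<and> {s\<in>S. translate_inv S s A \<in> q} \<in> p"
  by (simp add: uplus_def)

lemma ultrafilter_on_uplus:
  assumes S: "\<forall>s\<in>S. \<forall>t\<in>S. s + t \<in> S"
    and p: "ultrafilter_on S p" and q: "ultrafilter_on S q"
  shows "ultrafilter_on S (uplus S p q)"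
  unfolding ultrafilter_on_def
proof (intro conjI ballI allI impI)
  show "uplus S p q \<subseteq> Pow S" by (auto simp: uplus_def)
  have "translate_inv S s S = S" if "s \<in> S" for s using S that by (auto simp: translate_inv_def)
  then have "{s\<in>S. translate_inv S s S \<in> q} = S" using ultrafilter_onD(2)[OF q] by auto
  then show "S \<in> uplus S p q" using ultrafilter_onD(2)[OF p] by (simp add: mem_uplus_iff)
  have "{s\<in>S. translate_inv S s {} \<in> q} = {}"
    using ultrafilter_onD(3)[OF q] by (auto simp: translate_inv_def)
  then show "{} \<notin> uplus S p q" using ultrafilter_onD(3)[OF p] by (simp only: mem_uplus_iff simp_thms)
  show "B \<in> uplus S p q" if "A \<in> uplus S p q" "A \<subseteq> B \<and> B \<subseteq> S" for A B
  proof -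
    have "translate_inv S s B \<in> q" if "translate_inv S s A \<in> q" for s
      using that
      by (rule ultrafilter_onD(5)[OF q]) (use \<open>A \<subseteq> B \<and> B \<subseteq> S\<close> in \<open>auto simp: translate_inv_def\<close>)
    then have "{s\<in>S. translate_inv S s B \<in> q} \<in> p"
      using \<open>A \<in> uplus S p q\<close> ultrafilter_onD(5)[OF p, of "{s\<in>S. translate_inv S s A \<in> q}"]
      by (simp add: mem_uplus_iff subset_iff)
    then show ?thesis using that by (simp add: mem_uplus_iff)
  qed
  show "A \<inter> B \<in> uplus S p q" if "A \<in> uplus S p q" "B \<in> uplus S p q" for A B
  proof -
    have "{s\<in>S. translate_inv S s A \<in> q} \<inter> {s\<in>S. translate_inv S s B \<in> q} \<in> p"
      using that ultrafilter_onD(4)[OF p] by (simp add: mem_uplus_iff)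
    moreover have "translate_inv S s A \<inter> translate_inv S s B = translate_inv S s (A \<inter> B)" for s
      by (auto simp: translate_inv_def)
    then have "{s\<in>S. translate_inv S s A \<in> q} \<inter> {s\<in>S. translate_inv S s B \<in> q}
        \<subseteq> {s\<in>S. translate_inv S s (A \<inter> B) \<in> q}" using ultrafilter_onD(4)[OF q] by force
    ultimately have "{s\<in>S. translate_inv S s (A \<inter> B) \<in> q} \<in> p"
      by (rule ultrafilter_onD(5)[OF p]) auto
    then show ?thesis using that by (auto simp: mem_uplus_iff)
  qed
  show "A \<in> uplus S p q \<or> S - A \<in> uplus S p q" if A: "A \<subseteq> S" for A
  proof -
    have "translate_inv S s (S - A) = S - translate_inv S s A" if "s \<in> S" for s
      using S that by (auto simp: translate_inv_def)
    then have "{s\<in>S. translate_inv S s (S - A) \<in> q} = S - {s\<in>S. translate_inv S s A \<in> q}"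
      using ultrafilter_onD(6)[OF q translate_inv_subset] by auto
    then show ?thesis using ultrafilter_onD(6)[OF p, of "{s\<in>S. translate_inv S s A \<in> q}"] A
      by (auto simp: mem_uplus_iff)
  qed
qed

lemma uplus_assoc:
  fixes S :: "'a::semigroup_add set"
  assumes S: "\<forall>s\<in>S. \<forall>t\<in>S. s + t \<in> S"
  shows "uplus S (uplus S p q) r = uplus S p (uplus S q r)"
proof -
  have 1: "translate_inv S u {s\<in>S. translate_inv S s A \<in> r}
      = {s\<in>S. translate_inv S s (translate_inv S u A) \<in> r}" if u: "u \<in> S" for u A
  proof -
    have "translate_inv S s (translate_inv S u A) = translate_inv S (u + s) A" if "s \<in> S" for s
      using S that u by (auto simp: translate_inv_def add.assoc)
    then show ?thesis using S u by (auto simp: translate_inv_def[of S u "{s\<in>S. translate_inv S s A \<in> r}"])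
  qed
  have "A \<in> uplus S (uplus S p q) r \<longleftrightarrow> A \<in> uplus S p (uplus S q r)" for A
  proof -
    have "{u\<in>S. translate_inv S u {s\<in>S. translate_inv S s A \<in> r} \<in> q}
        = {u\<in>S. translate_inv S u A \<in> uplus S q r}"
      by (auto simp: 1 mem_uplus_iff translate_inv_subset)
    then show ?thesis
      unfolding mem_uplus_iff[of A S p] mem_uplus_iff[of A S "uplus S p q"]
        mem_uplus_iff[of "{s\<in>S. translate_inv S s A \<in> r}"] by auto
  qed
  then show ?thesis by blast
qed

text \<open>Under right addition of \<open>q\<close>, the preimage of the basic set of \<open>A\<close> is again a basic set, that of
  \<open>{s \<in> S. -s + A \<in> q}\<close>. Left addition has no such property in general, because \<open>-s + A\<close> varies
  with \<open>s\<close>.\<close>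

lemma continuous_map_uplus_left:
  assumes S: "\<forall>s\<in>S. \<forall>t\<in>S. s + t \<in> S" and q: "q \<in> stone_cech S"
  shows "continuous_map (stone_cech_topology S) (stone_cech_topology S) (\<lambda>p. uplus S p q)"
  unfolding continuous_map_def
proof (intro conjI allI impI)
  show maps: "(\<lambda>p. uplus S p q) \<in> topspace (stone_cech_topology S) \<rightarrow> topspace (stone_cech_topology S)"
    using ultrafilter_on_uplus[OF S] q by (auto simp: stone_cech_def)
  fix U assume U: "openin (stone_cech_topology S) U"
  show "openin (stone_cech_topology S) {p \<in> topspace (stone_cech_topology S). uplus S p q \<in> U}"
    unfolding openin_stone_cech_topology
  proof (intro conjI ballI)
    fix p assume p: "p \<in> {p \<in> topspace (stone_cech_topology S). uplus S p q \<in> U}"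
    then obtain A where A: "A \<in> uplus S p q" "{r \<in> stone_cech S. A \<in> r} \<subseteq> U"
      using U by (auto simp: openin_stone_cech_topology)
    have "{r \<in> stone_cech S. {s\<in>S. translate_inv S s A \<in> q} \<in> r}
        \<subseteq> {p \<in> topspace (stone_cech_topology S). uplus S p q \<in> U}"
      using A maps by (auto simp: mem_uplus_iff)
    then show "\<exists>A\<in>p. {r \<in> stone_cech S. A \<in> r} \<subseteq> {p \<in> topspace (stone_cech_topology S). uplus S p q \<in> U}"
      using A(1) by (auto simp: mem_uplus_iff)
  qed auto
qed

section \<open>Idempotents and minimal left ideals in compact right topological semigroups\<close>

lemma minimal_nonempty_closed_set:
  assumes Y: "compact_space Y" and A: "P A"
    and closed: "\<And>A. P A \<Longrightarrow> closedin Y A \<and> A \<noteq> {}"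
    and Inter: "\<And>\<C>. \<C> \<noteq> {} \<Longrightarrow> (\<And>A. A \<in> \<C> \<Longrightarrow> P A) \<Longrightarrow> \<Inter>\<C> \<noteq> {} \<Longrightarrow> P (\<Inter>\<C>)"
  shows "\<exists>M\<subseteq>A. P M \<and> (\<forall>B\<subseteq>M. P B \<longrightarrow> B = M)"
proof -
  define Z where "Z = {B. P B \<and> B \<subseteq> A}"
  have "\<exists>M\<in>Z. \<forall>B\<in>Z. M \<supseteq> B \<longrightarrow> B = M"
  proof (rule predicate_Zorn)
    show "partial_order_on Z (relation_of (\<supseteq>) Z)"
      by (auto intro!: partial_order_on_relation_ofI)
    fix \<C> assume \<C>: "\<C> \<in> Chains (relation_of (\<supseteq>) Z)"
    then have sub: "\<C> \<subseteq> Z" and chain: "\<And>B C. B \<in> \<C> \<Longrightarrow> C \<in> \<C> \<Longrightarrow> B \<subseteq> C \<or> C \<subseteq> B"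
      by (auto simp: Chains_def relation_of_def)
    show "\<exists>U\<in>Z. \<forall>B\<in>\<C>. U \<subseteq> B"
    proof (cases "\<C> = {}")
      case True
      then show ?thesis using A by (auto simp: Z_def)
    next
      case False
      have "\<Inter>\<F> \<noteq> {}" if F: "finite \<F>" "\<F> \<subseteq> \<C>" for \<F>
      proof (cases "\<F> = {}")
        case False
        have "subset.chain UNIV \<F>" using F chain by (auto simp: subset_chain_def)
        then have "\<Inter>\<F> \<in> \<F>" using F False Inter_in_chain by blast
        then show ?thesis using F sub closed by (auto simp: Z_def)
      qed simp
      then have "\<forall>\<F>. finite \<F> \<and> \<F> \<subseteq> \<C> \<longrightarrow> \<Inter>\<F> \<noteq> {}" by simp
      moreover have "\<forall>C\<in>\<C>. closedin Y C" using sub closed by (auto simp: Z_def)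
      ultimately have "\<Inter>\<C> \<noteq> {}"
        using Y[unfolded compact_space_fip, rule_format, of \<C>] by simp
      then have "P (\<Inter>\<C>)" using Inter False sub by (auto simp: Z_def)
      moreover have "\<Inter>\<C> \<subseteq> A" using False sub by (auto simp: Z_def)
      ultimately show ?thesis by (auto simp: Z_def)
    qed
  qed
  then obtain M where "M \<in> Z" "\<forall>B\<in>Z. M \<supseteq> B \<longrightarrow> B = M" by (elim bexE)
  then show ?thesis by (intro exI[of _ M]) (auto simp: Z_def)
qed

locale compact_right_topological_semigroup =
  fixes Y :: "'c topology" and f :: "'c \<Rightarrow> 'c \<Rightarrow> 'c" (infixl "\<odot>" 70)
  assumes compact: "compact_space Y" and Hausdorff: "Hausdorff_space Y"
    and nonempty: "topspace Y \<noteq> {}"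
    and closed: "\<And>a b. a \<in> topspace Y \<Longrightarrow> b \<in> topspace Y \<Longrightarrow> a \<odot> b \<in> topspace Y"
    and assoc: "\<And>a b c. a \<in> topspace Y \<Longrightarrow> b \<in> topspace Y \<Longrightarrow> c \<in> topspace Y \<Longrightarrow>
      (a \<odot> b) \<odot> c = a \<odot> (b \<odot> c)"
    and continuous: "\<And>b. b \<in> topspace Y \<Longrightarrow> continuous_map Y Y (\<lambda>a. a \<odot> b)"
begin

lemma closedin_translate:
  assumes "closedin Y A" "b \<in> topspace Y"
  shows "closedin Y ((\<lambda>a. a \<odot> b) ` A)"
proof -
  have "compactin Y A" using assms(1) compact by (simp add: closedin_compact_space)
  then have "compactin Y ((\<lambda>a. a \<odot> b) ` A)" using continuous[OF assms(2)] by (rule image_compactin)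
  then show ?thesis using Hausdorff by (simp add: compactin_imp_closedin)
qed

text \<open>Ellis's lemma. In a minimal closed subsemigroup \<open>M\<close> with \<open>p \<in> M\<close>, minimality gives
  \<open>M \<odot> p = M\<close>, so \<open>{q \<in> M. q \<odot> p = p}\<close> is a nonempty closed subsemigroup and equals \<open>M\<close>; hence
  it contains \<open>p\<close>.\<close>

lemma closed_subsemigroup_has_idempotent:
  assumes "closedin Y A" "A \<noteq> {}" "\<And>a b. a \<in> A \<Longrightarrow> b \<in> A \<Longrightarrow> a \<odot> b \<in> A"
  shows "\<exists>p\<in>A. p \<odot> p = p"
proof -
  define P where "P B \<longleftrightarrow> closedin Y B \<and> B \<noteq> {} \<and> (\<forall>a\<in>B. \<forall>b\<in>B. a \<odot> b \<in> B)" for B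
  have "\<exists>M\<subseteq>A. P M \<and> (\<forall>B\<subseteq>M. P B \<longrightarrow> B = M)"
  proof (rule minimal_nonempty_closed_set[OF compact])
    show "P A" using assms by (auto simp: P_def)
    show "P (\<Inter>\<C>)" if "\<C> \<noteq> {}" "\<And>A. A \<in> \<C> \<Longrightarrow> P A" "\<Inter>\<C> \<noteq> {}" for \<C>
      using that by (auto simp: P_def intro!: closedin_Inter)
  qed (simp add: P_def)
  then obtain M where M: "M \<subseteq> A" "P M" and min: "\<And>B. B \<subseteq> M \<Longrightarrow> P B \<Longrightarrow> B = M" by blast
  have clM: "closedin Y M" and mulM: "\<And>a b. a \<in> M \<Longrightarrow> b \<in> M \<Longrightarrow> a \<odot> b \<in> M" using M by (auto simp: P_def)
  have MY: "M \<subseteq> topspace Y" using clM by (rule closedin_subset)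
  obtain p where p: "p \<in> M" using M by (auto simp: P_def)
  have pY: "p \<in> topspace Y" using p MY by blast
  have "P ((\<lambda>a. a \<odot> p) ` M)"
    unfolding P_def
  proof (intro conjI ballI)
    show "closedin Y ((\<lambda>a. a \<odot> p) ` M)" using closedin_translate[OF clM pY] .
    fix x y assume "x \<in> (\<lambda>a. a \<odot> p) ` M" "y \<in> (\<lambda>a. a \<odot> p) ` M"
    then obtain a b where ab: "a \<in> M" "b \<in> M" "x = a \<odot> p" "y = b \<odot> p" by auto
    have xM: "x \<in> M" using ab p mulM by simp
    then have "(x \<odot> b) \<odot> p = x \<odot> y" using ab(2,4) MY pY assoc[of x b p] by auto
    moreover have "x \<odot> b \<in> M" using xM ab(2) by (rule mulM)
    ultimately show "x \<odot> y \<in> (\<lambda>a. a \<odot> p) ` M" by (metis imageI)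
  qed (use p in blast)
  then have "(\<lambda>a. a \<odot> p) ` M = M" using p mulM by (intro min) auto
  then have "p \<in> (\<lambda>a. a \<odot> p) ` M" using p by simp
  then have ne: "{q\<in>M. q \<odot> p = p} \<noteq> {}" by auto
  have "closedin Y {q\<in>topspace Y. q \<odot> p \<in> {p}}"
    by (rule closedin_continuous_map_preimage[OF continuous[OF pY]
        closedin_Hausdorff_singleton[OF Hausdorff pY]])
  then have "closedin Y (M \<inter> {q\<in>topspace Y. q \<odot> p \<in> {p}})" using clM by (rule closedin_Int[rotated])
  moreover have "M \<inter> {q\<in>topspace Y. q \<odot> p \<in> {p}} = {q\<in>M. q \<odot> p = p}" using MY by blast
  ultimately have "closedin Y {q\<in>M. q \<odot> p = p}" by simp
  then have "P {q\<in>M. q \<odot> p = p}" unfolding P_def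
  proof (intro conjI ballI)
    fix a b assume "a \<in> {q\<in>M. q \<odot> p = p}" "b \<in> {q\<in>M. q \<odot> p = p}"
    then show "a \<odot> b \<in> {q\<in>M. q \<odot> p = p}" using mulM p MY assoc[of a b p] by auto
  qed (use ne in auto)
  then have "{q\<in>M. q \<odot> p = p} = M" by (intro min) auto
  then show ?thesis using p M(1) by blast
qed

definition left_ideal :: "'c set \<Rightarrow> bool" where
  "left_ideal J \<longleftrightarrow> J \<noteq> {} \<and> J \<subseteq> topspace Y \<and> (\<forall>c\<in>topspace Y. \<forall>j\<in>J. c \<odot> j \<in> J)"

definition minimal_left_ideal :: "'c set \<Rightarrow> bool" where
  "minimal_left_ideal L \<longleftrightarrow> left_ideal L \<and> (\<forall>J\<subseteq>L. left_ideal J \<longrightarrow> J = L)"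

lemma left_ideal_principal:
  assumes "b \<in> topspace Y"
  shows "left_ideal ((\<lambda>a. a \<odot> b) ` topspace Y)"
  unfolding left_ideal_def
proof (intro conjI ballI)
  fix c j assume "c \<in> topspace Y" "j \<in> (\<lambda>a. a \<odot> b) ` topspace Y"
  then obtain a where "a \<in> topspace Y" "j = a \<odot> b" by auto
  then have "c \<odot> j = (c \<odot> a) \<odot> b" "c \<odot> a \<in> topspace Y"
    using \<open>c \<in> topspace Y\<close> assms assoc[of c a b] closed by auto
  then show "c \<odot> j \<in> (\<lambda>a. a \<odot> b) ` topspace Y" by blast
qed (use assms nonempty closed in auto)

lemma principal_subset_left_ideal:
  assumes "left_ideal J" "b \<in> J"
  shows "(\<lambda>a. a \<odot> b) ` topspace Y \<subseteq> J"
  using assms by (auto simp: left_ideal_def)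

lemma minimal_left_ideal_eq_principal:
  assumes "minimal_left_ideal L" "b \<in> L"
  shows "(\<lambda>a. a \<odot> b) ` topspace Y = L"
proof -
  have "left_ideal L" "b \<in> topspace Y" using assms by (auto simp: minimal_left_ideal_def left_ideal_def)
  then show ?thesis
    using assms left_ideal_principal principal_subset_left_ideal by (simp add: minimal_left_ideal_def)
qed

lemma closedin_minimal_left_ideal:
  assumes "minimal_left_ideal L"
  shows "closedin Y L"
proof -
  obtain b where b: "b \<in> L" "b \<in> topspace Y"
    using assms by (auto simp: minimal_left_ideal_def left_ideal_def)
  then show ?thesis
    using minimal_left_ideal_eq_principal[OF assms b(1)] closedin_translate[OF closedin_topspace b(2)]
    by simp
qed

text \<open>Every left ideal contains a closed one, namely \<open>topspace Y \<odot> b\<close>, so it is enough to find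
  a minimal closed left ideal.\<close>

lemma left_ideal_contains_minimal:
  assumes "left_ideal J"
  shows "\<exists>L\<subseteq>J. minimal_left_ideal L"
proof -
  obtain b where b: "b \<in> J" "b \<in> topspace Y" using assms by (auto simp: left_ideal_def)
  define P where "P B \<longleftrightarrow> closedin Y B \<and> left_ideal B" for B
  have "\<exists>M\<subseteq>(\<lambda>a. a \<odot> b) ` topspace Y. P M \<and> (\<forall>B\<subseteq>M. P B \<longrightarrow> B = M)"
  proof (rule minimal_nonempty_closed_set[OF compact])
    show "P ((\<lambda>a. a \<odot> b) ` topspace Y)"
      using left_ideal_principal closedin_translate b by (simp add: P_def)
    show "P (\<Inter>\<C>)" if \<C>: "\<C> \<noteq> {}" "\<And>A. A \<in> \<C> \<Longrightarrow> P A" "\<Inter>\<C> \<noteq> {}" for \<C>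
    proof -
      have "closedin Y (\<Inter>\<C>)" using \<C> by (auto simp: P_def intro!: closedin_Inter)
      moreover from this have "\<Inter>\<C> \<subseteq> topspace Y" by (rule closedin_subset)
      ultimately show ?thesis using \<C>(2,3) by (auto simp: P_def left_ideal_def)
    qed
  qed (auto simp: P_def left_ideal_def)
  then obtain M where M: "M \<subseteq> (\<lambda>a. a \<odot> b) ` topspace Y" "P M"
    and min: "\<And>B. B \<subseteq> M \<Longrightarrow> P B \<Longrightarrow> B = M" by blast
  have "I = M" if I: "I \<subseteq> M" "left_ideal I" for I
  proof -
    obtain c where c: "c \<in> I" "c \<in> topspace Y" using I by (auto simp: left_ideal_def)
    have "(\<lambda>a. a \<odot> c) ` topspace Y \<subseteq> I" using principal_subset_left_ideal[OF I(2) c(1)] .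
    moreover from this have "(\<lambda>a. a \<odot> c) ` topspace Y = M"
      using I c left_ideal_principal closedin_translate by (intro min) (auto simp: P_def)
    ultimately show ?thesis using I by blast
  qed
  then have "minimal_left_ideal M" using M by (auto simp: minimal_left_ideal_def P_def)
  then show ?thesis using M(1) principal_subset_left_ideal[OF assms b(1)] by blast
qed

lemma minimal_left_ideal_translate:
  assumes L: "minimal_left_ideal L" and c: "c \<in> topspace Y"
  shows "minimal_left_ideal ((\<lambda>a. a \<odot> c) ` L)"
proof -
  have lL: "left_ideal L" using L by (simp add: minimal_left_ideal_def)
  then have LY: "L \<subseteq> topspace Y" by (simp add: left_ideal_def)
  have "left_ideal ((\<lambda>a. a \<odot> c) ` L)"
    unfolding left_ideal_def
  proof (intro conjI ballI)
    fix d j assume "d \<in> topspace Y" "j \<in> (\<lambda>a. a \<odot> c) ` L"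
    then obtain a where a: "a \<in> L" "j = a \<odot> c" by auto
    then have "d \<odot> j = (d \<odot> a) \<odot> c" using \<open>d \<in> topspace Y\<close> c LY assoc[of d a c] by auto
    moreover have "d \<odot> a \<in> L" using lL a \<open>d \<in> topspace Y\<close> by (simp add: left_ideal_def)
    ultimately show "d \<odot> j \<in> (\<lambda>a. a \<odot> c) ` L" by blast
  qed (use lL c closed in \<open>auto simp: left_ideal_def\<close>)
  moreover have "I = (\<lambda>a. a \<odot> c) ` L" if I: "I \<subseteq> (\<lambda>a. a \<odot> c) ` L" "left_ideal I" for I
  proof -
    have "left_ideal {a\<in>L. a \<odot> c \<in> I}"
      unfolding left_ideal_def
    proof (intro conjI ballI)
      show "{a\<in>L. a \<odot> c \<in> I} \<noteq> {}" using I by (auto simp: left_ideal_def)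
      fix d a assume d: "d \<in> topspace Y" and a: "a \<in> {a\<in>L. a \<odot> c \<in> I}"
      have "(d \<odot> a) \<odot> c = d \<odot> (a \<odot> c)" using d a c LY by (auto intro: assoc)
      then show "d \<odot> a \<in> {a\<in>L. a \<odot> c \<in> I}" using d a lL I(2) by (auto simp: left_ideal_def)
    qed (use LY in blast)
    then have "{a\<in>L. a \<odot> c \<in> I} = L" using L by (auto simp: minimal_left_ideal_def)
    then show ?thesis using I by blast
  qed
  ultimately show ?thesis by (simp add: minimal_left_ideal_def)
qed

text \<open>The union of the minimal left ideals is a right ideal because right translates of minimal left
  ideals are again minimal. It lies in every two-sided ideal \<open>I\<close> because \<open>I\<close> meets every left
  ideal \<open>L\<close>, in a left ideal contained in \<open>L\<close>.\<close>

theorem smallest_ideal_eq_Union: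
  "smallest_ideal (\<odot>) (topspace Y) = \<Union>{L. minimal_left_ideal L}"
  unfolding smallest_ideal_def
proof (rule Least_equality)
  have "left_ideal (topspace Y)" using nonempty closed by (simp add: left_ideal_def)
  then obtain L0 where L0: "minimal_left_ideal L0" using left_ideal_contains_minimal[of "topspace Y"] by auto
  show "two_sided_ideal (\<odot>) (topspace Y) (\<Union>{L. minimal_left_ideal L})"
    unfolding two_sided_ideal_def
  proof (intro conjI ballI)
    have "L0 \<noteq> {}" using L0 by (simp add: minimal_left_ideal_def left_ideal_def)
    then show "\<Union>{L. minimal_left_ideal L} \<noteq> {}" using L0 by blast
    show "\<Union>{L. minimal_left_ideal L} \<subseteq> topspace Y"
      by (auto simp: minimal_left_ideal_def left_ideal_def)
    fix c i assume c: "c \<in> topspace Y" and "i \<in> \<Union>{L. minimal_left_ideal L}"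
    then obtain L where L: "minimal_left_ideal L" "i \<in> L" by blast
    then have "c \<odot> i \<in> L" using c by (simp add: minimal_left_ideal_def left_ideal_def)
    then show "c \<odot> i \<in> \<Union>{L. minimal_left_ideal L}" using L(1) by blast
    show "i \<odot> c \<in> \<Union>{L. minimal_left_ideal L}"
      using minimal_left_ideal_translate[OF L(1) c] L(2) by blast
  qed
  fix I assume I: "two_sided_ideal (\<odot>) (topspace Y) I"
  have "L \<subseteq> I" if L: "minimal_left_ideal L" for L
  proof -
    have lL: "left_ideal L" using L by (simp add: minimal_left_ideal_def)
    have "I \<noteq> {}" "L \<noteq> {}" using I lL by (simp_all add: two_sided_ideal_def left_ideal_def)
    then obtain i l where il: "i \<in> I" "l \<in> L" by blast
    then have "i \<in> topspace Y" "l \<in> topspace Y"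
      using I lL unfolding two_sided_ideal_def left_ideal_def by auto
    then have "i \<odot> l \<in> I \<inter> L"
      using I lL il by (simp add: two_sided_ideal_def left_ideal_def)
    then have "left_ideal (I \<inter> L)"
      using I lL unfolding two_sided_ideal_def left_ideal_def by auto
    then have "I \<inter> L = L" using L by (simp add: minimal_left_ideal_def)
    then show ?thesis by blast
  qed
  then show "\<Union>{L. minimal_left_ideal L} \<subseteq> I" by blast
qed

end

section \<open>The semigroup of ultrafilters near an idempotent\<close>

lemma closedin_ultrafilters_near:
  fixes S :: "'a::topological_space set"
  shows "closedin (stone_cech_topology S) (ultrafilters_near S e)"
proof -
  have "ultrafilters_near S e
      = (\<Inter>V\<in>{V. open V \<and> e \<in> V}. {p \<in> stone_cech S. S \<inter> V \<in> p})"
    (is "?L = ?R")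
  proof (rule antisym)
    show "?R \<subseteq> ?L"
    proof
      fix p assume p: "p \<in> ?R"
      then have "p \<in> stone_cech S" using open_UNIV by blast
      then show "p \<in> ?L" using p by (simp add: ultrafilters_near_iff stone_cech_def)
    qed
  qed (auto simp: ultrafilters_near_iff stone_cech_def)
  then show ?thesis
    by (auto intro!: closedin_INT closedin_basic)
qed

text \<open>Separate continuity suffices. Since \<open>e + e = e\<close>, continuity of the right translation by \<open>e\<close>
  shows that \<open>s + e\<close> lies in a given open neighbourhood \<open>V\<close> of \<open>e\<close> for all \<open>s\<close> near \<open>e\<close>. For each
  such \<open>s\<close>, continuity of the left translation by \<open>s\<close> shows that \<open>s + t\<close> lies in \<open>V\<close> for all \<open>t\<close> near
  \<open>e\<close>, where how near may depend on \<open>s\<close>.\<close>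

lemma uplus_near:
  fixes S :: "'a::semitopological_semigroup_add set"
  assumes S: "\<forall>s\<in>S. \<forall>t\<in>S. s + t \<in> S" and e: "e + e = e"
    and p: "p \<in> ultrafilters_near S e" and q: "q \<in> ultrafilters_near S e"
  shows "uplus S p q \<in> ultrafilters_near S e"
proof -
  have up: "ultrafilter_on S p" and uq: "ultrafilter_on S q"
    using p q by (auto simp: ultrafilters_near_iff)
  have "S \<inter> V \<in> uplus S p q" if V: "open V" "e \<in> V" for V
  proof -
    have "open {s. s + e \<in> V}"
      using open_vimage[OF V(1) continuous_on_translations(2)[of e]] by (simp add: vimage_def)
    then have "S \<inter> {s. s + e \<in> V} \<in> p" using p e V by (auto simp: ultrafilters_near_iff)
    moreover have "translate_inv S s (S \<inter> V) \<in> q" if s: "s \<in> S" "s + e \<in> V" for s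
    proof -
      have "open {t. s + t \<in> V}"
        using open_vimage[OF V(1) continuous_on_translations(1)[of s]] by (simp add: vimage_def)
      then have "S \<inter> {t. s + t \<in> V} \<in> q" using q s by (auto simp: ultrafilters_near_iff)
      moreover have "S \<inter> {t. s + t \<in> V} = translate_inv S s (S \<inter> V)"
        using S s by (auto simp: translate_inv_def)
      ultimately show ?thesis by simp
    qed
    then have "S \<inter> {s. s + e \<in> V} \<subseteq> {s\<in>S. translate_inv S s (S \<inter> V) \<in> q}" by blast
    ultimately have "{s\<in>S. translate_inv S s (S \<inter> V) \<in> q} \<in> p"
      by (rule ultrafilter_onD(5)[OF up]) auto
    then show ?thesis by (simp add: mem_uplus_iff)
  qed
  then show ?thesis using ultrafilter_on_uplus[OF S up uq] by (simp add: ultrafilters_near_iff)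
qed

definition near_topology :: "'a::topological_space set \<Rightarrow> 'a \<Rightarrow> 'a set set topology" where
  "near_topology S e = subtopology (stone_cech_topology S) (ultrafilters_near S e)"

lemma topspace_near_topology [simp]: "topspace (near_topology S e) = ultrafilters_near S e"
  by (auto simp: near_topology_def ultrafilters_near_def)

lemma dense_subsemigroup_plus: "dense_subsemigroup S \<Longrightarrow> \<forall>s\<in>S. \<forall>t\<in>S. s + t \<in> S"
  by (simp add: dense_subsemigroup_def)

theorem compact_right_topological_semigroup_near:
  assumes "dense_subsemigroup S" "e + e = e"
  shows "compact_right_topological_semigroup (near_topology S e) (uplus S)"
proof
  note plus = dense_subsemigroup_plus[OF assms(1)]
  show "compact_space (near_topology S e)"
    unfolding near_topology_def
    by (intro compact_space_subtopology closedin_compact_space[OF compact_space_stone_cech]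
        closedin_ultrafilters_near)
  show "Hausdorff_space (near_topology S e)"
    unfolding near_topology_def by (intro Hausdorff_space_subtopology Hausdorff_space_stone_cech)
  have "\<exists>p\<in>ultrafilters_near S e. {S} \<subseteq> p"
    using assms(1) by (intro ultrafilter_near_extending) (auto simp: dense_subsemigroup_def)
  then show "topspace (near_topology S e) \<noteq> {}" by auto
  fix a b assume ab: "a \<in> topspace (near_topology S e)" "b \<in> topspace (near_topology S e)"
  then show "uplus S a b \<in> topspace (near_topology S e)"
    using uplus_near[OF plus assms(2)] by simp
  show "uplus S (uplus S a b) c = uplus S a (uplus S b c)" for c
    by (rule uplus_assoc[OF plus])
next
  note plus = dense_subsemigroup_plus[OF assms(1)]
  fix b assume b: "b \<in> topspace (near_topology S e)"
  then have "continuous_map (stone_cech_topology S) (stone_cech_topology S) (\<lambda>a. uplus S a b)"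
    by (intro continuous_map_uplus_left[OF plus]) (simp_all add: ultrafilters_near_def)
  then show "continuous_map (near_topology S e) (near_topology S e) (\<lambda>a. uplus S a b)"
    unfolding near_topology_def
    using uplus_near[OF plus assms(2)] b
    by (auto simp: continuous_map_in_subtopology intro: continuous_map_from_subtopology)
qed

section \<open>Limits of orbits along ultrafilters\<close>

definition filter_of_ultrafilter :: "'a set \<Rightarrow> 'a set set \<Rightarrow> 'a filter" where
  "filter_of_ultrafilter S p = Abs_filter (\<lambda>P. {s\<in>S. P s} \<in> p)"

lemma eventually_filter_of_ultrafilter:
  assumes "ultrafilter_on S p"
  shows "eventually P (filter_of_ultrafilter S p) \<longleftrightarrow> {s\<in>S. P s} \<in> p"
  unfolding filter_of_ultrafilter_def
proof (rule eventually_Abs_filter, rule is_filter.intro)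
  show "{s\<in>S. True} \<in> p" using ultrafilter_onD(2)[OF assms] by simp
  show "{s\<in>S. P s \<and> Q s} \<in> p" if "{s\<in>S. P s} \<in> p" "{s\<in>S. Q s} \<in> p" for P Q
  proof -
    have "{s\<in>S. P s} \<inter> {s\<in>S. Q s} = {s\<in>S. P s \<and> Q s}" by auto
    then show ?thesis using ultrafilter_onD(4)[OF assms that] by simp
  qed
  show "{s\<in>S. Q s} \<in> p" if "\<forall>s. P s \<longrightarrow> Q s" "{s\<in>S. P s} \<in> p" for P Q
    using that(2) by (rule ultrafilter_onD(5)[OF assms]) (use that(1) in auto)
qed

lemma filter_of_ultrafilter_neq_bot: "ultrafilter_on S p \<Longrightarrow> filter_of_ultrafilter S p \<noteq> bot"
  using ultrafilter_onD(3)[of S p] by (auto simp: trivial_limit_def eventually_filter_of_ultrafilter)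

text \<open>If no point were a limit, each would have an open neighbourhood whose preimage is not in \<open>p\<close>.
  Finitely many of these cover the space, so one of finitely many preimages with union \<open>S\<close> is in \<open>p\<close>.\<close>

lemma compact_space_ultrafilter_limit:
  assumes X: "compact_space X" and p: "ultrafilter_on S p"
    and f: "\<And>s. s \<in> S \<Longrightarrow> f s \<in> topspace X"
  shows "\<exists>l. limitin X f l (filter_of_ultrafilter S p)"
proof (rule ccontr)
  assume no: "\<not> ?thesis"
  define \<U> where "\<U> = {U. openin X U \<and> {s\<in>S. f s \<in> U} \<notin> p}"
  have "l \<in> \<Union>\<U>" if "l \<in> topspace X" for l
    using no that by (auto simp: limitin_def eventually_filter_of_ultrafilter[OF p] \<U>_def)
  then have "topspace X \<subseteq> \<Union>\<U>" by auto
  moreover have "\<forall>U\<in>\<U>. openin X U" by (simp add: \<U>_def)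
  ultimately obtain F where F: "finite F" "F \<subseteq> \<U>" "topspace X \<subseteq> \<Union>F"
    using X[unfolded compact_space_alt, rule_format, of \<U>] by auto
  have "(\<Union>U\<in>F. {s\<in>S. f s \<in> U}) = S" using F(3) f by blast
  then have "\<exists>U\<in>F. {s\<in>S. f s \<in> U} \<in> p"
    using ultrafilter_on_finite_Union[OF p F(1), of "\<lambda>U. {s\<in>S. f s \<in> U}"] ultrafilter_onD(2)[OF p]
    by auto
  then show False using F(2) by (auto simp: \<U>_def)
qed

definition orbit_limit ::
    "'a set \<Rightarrow> 'x topology \<Rightarrow> ('a \<Rightarrow> 'x \<Rightarrow> 'x) \<Rightarrow> 'a set set \<Rightarrow> 'x \<Rightarrow> 'x \<Rightarrow> bool" where
  "orbit_limit S X act p x l \<longleftrightarrow> limitin X (\<lambda>s. act s x) l (filter_of_ultrafilter S p)"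

lemma orbit_limit_iff:
  assumes "ultrafilter_on S p"
  shows "orbit_limit S X act p x l \<longleftrightarrow>
    l \<in> topspace X \<and> (\<forall>U. openin X U \<and> l \<in> U \<longrightarrow> {s\<in>S. act s x \<in> U} \<in> p)"
  by (simp add: orbit_limit_def limitin_def eventually_filter_of_ultrafilter[OF assms])

lemma orbit_limit_in_topspace: "orbit_limit S X act p x l \<Longrightarrow> l \<in> topspace X"
  by (simp add: orbit_limit_def limitin_def)

lemma dynamical_system_act_in:
  "dynamical_system S X act \<Longrightarrow> s \<in> S \<Longrightarrow> x \<in> topspace X \<Longrightarrow> act s x \<in> topspace X"
  by (auto simp: dynamical_system_def continuous_map_def)

lemma orbit_limit_exists:
  assumes "dynamical_system S X act" "ultrafilter_on S p" "x \<in> topspace X"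
  shows "\<exists>l. orbit_limit S X act p x l"
  unfolding orbit_limit_def
  by (rule compact_space_ultrafilter_limit[OF _ assms(2) dynamical_system_act_in[OF assms(1) _ assms(3)]])
    (use assms(1) in \<open>simp add: dynamical_system_def\<close>)

lemma orbit_limit_unique:
  assumes "dynamical_system S X act" "ultrafilter_on S p"
    and "orbit_limit S X act p x l" "orbit_limit S X act p x m"
  shows "l = m"
  using assms(3,4) filter_of_ultrafilter_neq_bot[OF assms(2)] assms(1)
  unfolding orbit_limit_def dynamical_system_def
  by (elim conjE) (rule limitin_Hausdorff_unique)

text \<open>The action extends from \<open>S\<close> to ultrafilters: the limit along \<open>p\<close> of the limit along \<open>q\<close> is
  the limit along \<open>p + q\<close>.\<close>

lemma orbit_limit_uplus:
  assumes D: "dynamical_system S X act" and S: "\<forall>s\<in>S. \<forall>t\<in>S. s + t \<in> S"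
    and p: "ultrafilter_on S p" and q: "ultrafilter_on S q" and x: "x \<in> topspace X"
    and z: "orbit_limit S X act q x z" and l: "orbit_limit S X act p z l"
  shows "orbit_limit S X act (uplus S p q) x l"
  unfolding orbit_limit_iff[OF ultrafilter_on_uplus[OF S p q]]
proof (intro conjI allI impI)
  show "l \<in> topspace X" using l by (rule orbit_limit_in_topspace)
  fix U assume U: "openin X U \<and> l \<in> U"
  have "translate_inv S s {u\<in>S. act u x \<in> U} \<in> q" if s: "s \<in> S" "act s z \<in> U" for s
  proof -
    have "openin X {w\<in>topspace X. act s w \<in> U}"
      by (rule openin_continuous_map_preimage[of X X]) (use D s(1) U in \<open>simp_all add: dynamical_system_def\<close>)
    moreover have "z \<in> {w\<in>topspace X. act s w \<in> U}" using s orbit_limit_in_topspace[OF z] by simp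
    ultimately have "{t\<in>S. act t x \<in> {w\<in>topspace X. act s w \<in> U}} \<in> q"
      using z by (simp only: orbit_limit_iff[OF q])
    then show ?thesis
      by (rule ultrafilter_onD(5)[OF q])
        (use D S s(1) x in \<open>auto simp: translate_inv_def dynamical_system_def\<close>)
  qed
  then have "{s\<in>S. act s z \<in> U} \<subseteq> {s\<in>S. translate_inv S s {u\<in>S. act u x \<in> U} \<in> q}" by blast
  moreover have "{s\<in>S. act s z \<in> U} \<in> p" using l U by (simp add: orbit_limit_iff[OF p])
  ultimately have "{s\<in>S. translate_inv S s {u\<in>S. act u x \<in> U} \<in> q} \<in> p"
    using ultrafilter_onD(5)[OF p] by auto
  then show "{u\<in>S. act u x \<in> U} \<in> uplus S p q" by (simp add: mem_uplus_iff)
qed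

text \<open>Convergence of the orbit to \<open>z\<close> is a conjunction of conditions, each saying that a certain set
  belongs to \<open>p\<close>, and each such condition defines a clopen set.\<close>

lemma closedin_orbit_limit:
  assumes "z \<in> topspace X"
  shows "closedin (stone_cech_topology S) {p \<in> stone_cech S. orbit_limit S X act p x z}"
proof -
  have "closedin (stone_cech_topology S)
      (\<Inter>U\<in>{U. openin X U \<and> z \<in> U}. {p \<in> stone_cech S. {s\<in>S. act s x \<in> U} \<in> p})"
    by (rule closedin_INT) (use assms in \<open>auto intro!: closedin_basic\<close>)
  moreover have "{p \<in> stone_cech S. orbit_limit S X act p x z}
      = (\<Inter>U\<in>{U. openin X U \<and> z \<in> U}. {p \<in> stone_cech S. {s\<in>S. act s x \<in> U} \<in> p})"
    (is "?L = ?R")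
  proof (rule antisym)
    show "?L \<subseteq> ?R" by (auto simp: orbit_limit_iff stone_cech_def)
    show "?R \<subseteq> ?L"
    proof
      fix p assume p: "p \<in> ?R"
      then have "p \<in> stone_cech S" using assms by blast
      then show "p \<in> ?L" using p assms by (simp add: orbit_limit_iff stone_cech_def)
    qed
  qed
  ultimately show ?thesis by simp
qed

section \<open>Proximality and uniform recurrence in terms of ultrafilters\<close>

text \<open>The sets of times at which the pair \<open>(x, y)\<close> is close to the diagonal form a filter base that
  accumulates at \<open>e\<close>. Along an ultrafilter that extends it the two orbits have the same limit: a pair
  of distinct limits would have a neighbourhood disjoint from a neighbourhood of the diagonal, which
  is closed in the compact Hausdorff space \<open>X \<times> X\<close>.\<close>

lemma proximal_near_imp_common_limit:
  assumes D: "dynamical_system S X act" and x: "x \<in> topspace X" and y: "y \<in> topspace X"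
    and prox: "proximal_near S e X act x y"
  shows "\<exists>p\<in>ultrafilters_near S e. \<exists>z. orbit_limit S X act p x z \<and> orbit_limit S X act p y z"
proof -
  have X: "compact_space X" "Hausdorff_space X" using D by (auto simp: dynamical_system_def)
  define \<Delta> where "\<Delta> = {(z, z) | z. z \<in> topspace X}"
  define R where "R N = {s\<in>S. (act s x, act s y) \<in> N}" for N
  define \<D> where "\<D> = R ` {N. openin (prod_topology X X) N \<and> \<Delta> \<subseteq> N}"
  have "\<exists>p\<in>ultrafilters_near S e. \<D> \<subseteq> p"
  proof (rule ultrafilter_near_extending)
    have "\<Delta> \<subseteq> topspace (prod_topology X X)" by (auto simp: \<Delta>_def)
    then have "R (topspace (prod_topology X X)) \<in> \<D>" unfolding \<D>_def
      by (intro imageI CollectI conjI openin_topspace)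
    then show "\<D> \<noteq> {}" by (metis empty_iff)
    show "\<D> \<subseteq> Pow S" by (auto simp: \<D>_def R_def)
    fix A B assume "A \<in> \<D>" "B \<in> \<D>"
    then obtain M N where MN: "A = R M" "B = R N" "openin (prod_topology X X) M" "\<Delta> \<subseteq> M"
      "openin (prod_topology X X) N" "\<Delta> \<subseteq> N" by (auto simp: \<D>_def)
    then have "R (M \<inter> N) \<in> \<D>" unfolding \<D>_def by (intro imageI) (auto intro: openin_Int)
    moreover have "R (M \<inter> N) \<subseteq> A \<inter> B" using MN by (auto simp: R_def)
    ultimately show "\<exists>C\<in>\<D>. C \<subseteq> A \<inter> B" by (rule bexI[rotated])
  next
    fix A assume "A \<in> \<D>"
    then obtain N where N: "A = R N" "openin (prod_topology X X) N" "\<Delta> \<subseteq> N" by (auto simp: \<D>_def)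
    then have N': "N \<in> nbhds_of (prod_topology X X) \<Delta>"
      using openin_subset[OF N(2)] by (simp add: nbhds_of_def interior_of_openin)
    show "e \<in> closure A"
      unfolding closure_iff_nhds_not_empty
    proof (intro allI impI)
      fix W V assume "V \<subseteq> W" "open V" "e \<in> V"
      then have "V \<in> nbhds_pt e" by (simp add: nbhds_of_def interior_open)
      then obtain s where "s \<in> S \<inter> V" "(act s x, act s y) \<in> N"
        using prox N' unfolding proximal_near_def \<Delta>_def by meson
      then show "A \<inter> W \<noteq> {}" using \<open>V \<subseteq> W\<close> by (auto simp: N(1) R_def)
    qed
  qed
  then obtain p where p: "p \<in> ultrafilters_near S e" "\<D> \<subseteq> p" by (elim bexE)
  then have u: "ultrafilter_on S p" by (simp add: ultrafilters_near_iff)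
  obtain a b where a: "orbit_limit S X act p x a" and b: "orbit_limit S X act p y b"
    using orbit_limit_exists[OF D u] x y by meson
  have "a = b"
  proof (rule ccontr)
    assume "a \<noteq> b"
    have "regular_space (prod_topology X X)"
      using X by (intro compact_Hausdorff_imp_regular_space)
        (simp_all add: compact_space_prod_topology Hausdorff_space_prod_topology)
    moreover have "closedin (prod_topology X X) \<Delta>"
    proof -
      have "\<Delta> = (\<lambda>z. (z, z)) ` topspace X" by (auto simp: \<Delta>_def)
      then show ?thesis using X(2) by (simp add: Hausdorff_space_closedin_diagonal)
    qed
    moreover have "(a, b) \<in> topspace (prod_topology X X) - \<Delta>"
      using \<open>a \<noteq> b\<close> orbit_limit_in_topspace[OF a] orbit_limit_in_topspace[OF b] by (auto simp: \<Delta>_def)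
    ultimately obtain M N where MN: "openin (prod_topology X X) M" "openin (prod_topology X X) N"
      "(a, b) \<in> M" "\<Delta> \<subseteq> N" "disjnt M N"
      unfolding regular_space_def by meson
    have "limitin (prod_topology X X) (\<lambda>s. (act s x, act s y)) (a, b) (filter_of_ultrafilter S p)"
      using a b by (simp add: limitin_pairwise orbit_limit_def o_def)
    then have "R M \<in> p"
      using MN by (simp add: limitin_def eventually_filter_of_ultrafilter[OF u] R_def)
    moreover have "R N \<in> p" using p(2) MN(2,4) by (auto simp: \<D>_def)
    ultimately have "R M \<inter> R N \<in> p" by (rule ultrafilter_onD(4)[OF u])
    moreover have "R M \<inter> R N = {}" using MN(5) by (auto simp: R_def disjnt_iff)
    ultimately show False using ultrafilter_onD(3)[OF u] by simp
  qed
  then show ?thesis using p(1) a b by blast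
qed

lemma common_limit_imp_proximal_near:
  assumes p: "p \<in> ultrafilters_near S e"
    and x: "orbit_limit S X act p x z" and y: "orbit_limit S X act p y z"
  shows "proximal_near S e X act x y"
  unfolding proximal_near_def
proof (intro ballI)
  fix U V assume U: "U \<in> nbhds_of (prod_topology X X) {(z, z) | z. z \<in> topspace X}"
    and V: "V \<in> nbhds_pt e"
  have u: "ultrafilter_on S p" using p by (simp add: ultrafilters_near_iff)
  define N where "N = prod_topology X X interior_of U"
  have N: "openin (prod_topology X X) N" "(z, z) \<in> N" "N \<subseteq> U"
    using U orbit_limit_in_topspace[OF x] by (auto simp: N_def nbhds_of_def interior_of_subset)
  have "limitin (prod_topology X X) (\<lambda>s. (act s x, act s y)) (z, z) (filter_of_ultrafilter S p)"
    using x y by (simp add: limitin_pairwise orbit_limit_def o_def)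
  then have "{s\<in>S. (act s x, act s y) \<in> N} \<in> p"
    using N by (simp add: limitin_def eventually_filter_of_ultrafilter[OF u])
  then have "{s\<in>S. (act s x, act s y) \<in> N} \<inter> (S \<inter> V) \<in> p"
    using ultrafilters_near_nbhd[OF p V] by (rule ultrafilter_onD(4)[OF u])
  then have "{s\<in>S. (act s x, act s y) \<in> N} \<inter> (S \<inter> V) \<noteq> {}" using ultrafilter_onD(3)[OF u] by metis
  then show "\<exists>s\<in>S \<inter> V. (act s x, act s y) \<in> U" using N(3) by auto
qed

text \<open>Let \<open>z = T_q y\<close>, let \<open>C\<close> be a closed neighbourhood of \<open>y\<close> and \<open>M\<close> the set of times at which \<open>y\<close>
  visits the interior of \<open>C\<close>. Syndeticity covers a neighbourhood of \<open>e\<close> by finitely many sets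
  \<open>-t + M\<close> with \<open>t\<close> near \<open>e\<close>, so \<open>q\<close> contains one of them, and then \<open>T_t z\<close> lies in \<open>C\<close>. Thus the
  return times of \<open>z\<close> to the neighbourhoods of \<open>y\<close> accumulate at \<open>e\<close>.\<close>

lemma uniformly_recurrent_near_imp_return:
  assumes D: "dynamical_system S X act" and S: "\<forall>s\<in>S. \<forall>t\<in>S. s + t \<in> S"
    and y: "y \<in> topspace X" and rec: "uniformly_recurrent_near S e X act y"
    and q: "q \<in> ultrafilters_near S e" and z: "orbit_limit S X act q y z"
  shows "\<exists>r\<in>ultrafilters_near S e. orbit_limit S X act r z y"
proof -
  have X: "compact_space X" "Hausdorff_space X" using D by (auto simp: dynamical_system_def)
  have u: "ultrafilter_on S q" using q by (simp add: ultrafilters_near_iff)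
  define R where "R N = {s\<in>S. act s z \<in> N}" for N
  define \<D> where "\<D> = R ` {N. openin X N \<and> y \<in> N}"
  have "\<exists>r\<in>ultrafilters_near S e. \<D> \<subseteq> r"
  proof (rule ultrafilter_near_extending)
    have "R (topspace X) \<in> \<D>" unfolding \<D>_def by (intro imageI) (simp add: y)
    then show "\<D> \<noteq> {}" by (metis empty_iff)
    show "\<D> \<subseteq> Pow S" by (auto simp: \<D>_def R_def)
    fix A B assume "A \<in> \<D>" "B \<in> \<D>"
    then obtain M N where MN: "A = R M" "B = R N" "openin X M" "y \<in> M" "openin X N" "y \<in> N"
      by (auto simp: \<D>_def)
    then have "R (M \<inter> N) \<in> \<D>" unfolding \<D>_def by (intro imageI) (auto intro: openin_Int)
    moreover have "R (M \<inter> N) \<subseteq> A \<inter> B" using MN by (auto simp: R_def)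
    ultimately show "\<exists>C\<in>\<D>. C \<subseteq> A \<inter> B" by (rule bexI[rotated])
  next
    fix A assume "A \<in> \<D>"
    then obtain N where N: "A = R N" "openin X N" "y \<in> N" by (auto simp: \<D>_def)
    \<comment> \<open>A smaller closed neighbourhood is needed because membership survives limits only in closed
      sets.\<close>
    have "neighbourhood_base_of (closedin X) X"
      using compact_Hausdorff_imp_regular_space[OF X] by (simp add: neighbourhood_base_of_closedin)
    then obtain W C where W: "openin X W" "closedin X C" "y \<in> W" "W \<subseteq> C" "C \<subseteq> N"
      unfolding neighbourhood_base_of using N by meson
    then have "W \<in> nbhds_of X {y}"
      using openin_subset[OF W(1)] by (simp add: nbhds_of_def interior_of_openin)
    then have synd: "syndetic_near S e {s\<in>S. act s y \<in> W}"
      using rec by (simp add: uniformly_recurrent_near_def)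
    show "e \<in> closure A"
      unfolding closure_iff_nhds_not_empty
    proof (intro allI impI)
      fix V' V assume V: "V \<subseteq> V'" "open V" "e \<in> V"
      then have "V \<in> nbhds_pt e" by (simp add: nbhds_of_def interior_open)
      then obtain F V0 where F: "finite F" "F \<subseteq> V \<inter> S" "V0 \<in> nbhds_pt e"
        "S \<inter> V0 \<subseteq> (\<Union>t\<in>F. translate_inv S t {s\<in>S. act s y \<in> W})"
        using synd unfolding syndetic_near_def by meson
      have "(\<Union>t\<in>F. translate_inv S t {s\<in>S. act s y \<in> W}) \<in> q"
        using ultrafilters_near_nbhd[OF q F(3)] F(4)
        by (rule ultrafilter_onD(5)[OF u]) (auto simp: translate_inv_def)
      then have "\<exists>t\<in>F. translate_inv S t {s\<in>S. act s y \<in> W} \<in> q"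
        by (rule ultrafilter_on_finite_Union[OF u F(1) translate_inv_subset])
      then obtain t where t: "t \<in> F" "translate_inv S t {s\<in>S. act s y \<in> W} \<in> q" by (elim bexE)
      have tS: "t \<in> S" "t \<in> V" using t(1) F(2) by auto
      have "act t z \<in> C"
      proof (rule ccontr)
        assume "act t z \<notin> C"
        then have zin: "z \<in> {w\<in>topspace X. act t w \<in> topspace X - C}"
          using orbit_limit_in_topspace[OF z] dynamical_system_act_in[OF D tS(1)] by simp
        have "continuous_map X X (act t)" using D tS(1) by (simp add: dynamical_system_def)
        then have "openin X {w\<in>topspace X. act t w \<in> topspace X - C}"
          using W(2) by (intro openin_continuous_map_preimage) auto
        then have "{s\<in>S. act s y \<in> {w\<in>topspace X. act t w \<in> topspace X - C}} \<in> q"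
          using z zin by (simp only: orbit_limit_iff[OF u])
        then have "{s\<in>S. act s y \<in> {w\<in>topspace X. act t w \<in> topspace X - C}}
            \<inter> translate_inv S t {s\<in>S. act s y \<in> W} \<in> q"
          using t(2) by (rule ultrafilter_onD(4)[OF u])
        moreover have "{s\<in>S. act s y \<in> {w\<in>topspace X. act t w \<in> topspace X - C}}
            \<inter> translate_inv S t {s\<in>S. act s y \<in> W} = {}"
          using D tS(1) y W(4) by (auto simp: translate_inv_def dynamical_system_def)
        ultimately show False using ultrafilter_onD(3)[OF u] by simp
      qed
      then show "A \<inter> V' \<noteq> {}" using tS V(1) W(5) by (auto simp: N(1) R_def)
    qed
  qed
  then obtain r where r: "r \<in> ultrafilters_near S e" "\<D> \<subseteq> r" by (elim bexE)
  then have "orbit_limit S X act r z y"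
    using y by (auto simp: orbit_limit_iff ultrafilters_near_iff \<D>_def R_def)
  then show ?thesis using r(1) by blast
qed

text \<open>If the set \<open>C\<close> of visits of \<open>y\<close> to \<open>W\<close> were not syndetic near \<open>e\<close>, then by compactness some \<open>q\<close>
  near \<open>e\<close> would contain no \<open>-s + C\<close> with \<open>s \<in> U\<close>. But \<open>T_q y\<close> returns to \<open>W\<close> at some time \<open>s \<in> U\<close>,
  and continuity of \<open>T_s\<close> puts \<open>-s + C\<close> into \<open>q\<close>.\<close>

lemma return_imp_uniformly_recurrent_near:
  assumes D: "dynamical_system S X act" and S: "dense_subsemigroup S" and y: "y \<in> topspace X"
    and return: "\<And>q. q \<in> ultrafilters_near S e \<Longrightarrow>
      \<exists>z. orbit_limit S X act q y z \<and> (\<exists>r\<in>ultrafilters_near S e. orbit_limit S X act r z y)"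
  shows "uniformly_recurrent_near S e X act y"
  unfolding uniformly_recurrent_near_def syndetic_near_def
proof (intro ballI, rule ccontr)
  fix W U assume W: "W \<in> nbhds_of X {y}" and U: "U \<in> nbhds_pt e"
  define C where "C = {s\<in>S. act s y \<in> W}"
  assume no: "\<not> (\<exists>F. finite F \<and> F \<noteq> {} \<and> F \<subseteq> U \<inter> S \<and>
      (\<exists>V\<in>nbhds_pt e. S \<inter> V \<subseteq> (\<Union>t\<in>F. translate_inv S t {s\<in>S. act s y \<in> W})))"
  \<comment> \<open>The family consists of the parts of \<open>S\<close> that finitely many translates of \<open>C\<close> fail to cover.\<close>
  define R where "R F = S - (\<Union>t\<in>F. translate_inv S t C)" for F
  define \<D> where "\<D> = R ` {F. finite F \<and> F \<noteq> {} \<and> F \<subseteq> U \<inter> S}"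
  have "e \<in> interior U" using U by (simp add: nbhds_of_def)
  moreover have "e \<in> closure S" using S by (simp add: dense_subsemigroup_def)
  ultimately have "interior U \<inter> closure S \<noteq> {}" by blast
  then have "interior U \<inter> S \<noteq> {}" by (simp add: open_Int_closure_eq_empty)
  then obtain t0 where t0: "t0 \<in> U \<inter> S" using interior_subset[of U] by blast
  have "\<exists>q\<in>ultrafilters_near S e. \<D> \<subseteq> q"
  proof (rule ultrafilter_near_extending)
    have "R {t0} \<in> \<D>" unfolding \<D>_def by (rule imageI) (use t0 in simp)
    then show "\<D> \<noteq> {}" by (metis empty_iff)
    show "\<D> \<subseteq> Pow S" by (auto simp: \<D>_def R_def)
    fix A B assume "A \<in> \<D>" "B \<in> \<D>"
    then obtain F G where FG: "A = R F" "B = R G" "finite F" "F \<noteq> {}" "F \<subseteq> U \<inter> S"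
      "finite G" "G \<subseteq> U \<inter> S" by (auto simp: \<D>_def)
    then have "R (F \<union> G) \<in> \<D>" unfolding \<D>_def by (intro imageI) auto
    moreover have "R (F \<union> G) \<subseteq> A \<inter> B" using FG by (auto simp: R_def)
    ultimately show "\<exists>C\<in>\<D>. C \<subseteq> A \<inter> B" by (rule bexI[rotated])
  next
    fix A assume "A \<in> \<D>"
    then obtain F where F: "A = R F" "finite F" "F \<noteq> {}" "F \<subseteq> U \<inter> S" by (auto simp: \<D>_def)
    show "e \<in> closure A"
      unfolding closure_iff_nhds_not_empty
    proof (intro allI impI)
      fix V' V assume V: "V \<subseteq> V'" "open V" "e \<in> V"
      then have "V \<in> nbhds_pt e" by (simp add: nbhds_of_def interior_open)
      then have "\<not> S \<inter> V \<subseteq> (\<Union>t\<in>F. translate_inv S t C)"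
        using no F(2-4) unfolding C_def by meson
      then show "A \<inter> V' \<noteq> {}" using V(1) by (auto simp: F(1) R_def)
    qed
  qed
  then obtain q where q: "q \<in> ultrafilters_near S e" "\<D> \<subseteq> q" by (elim bexE)
  then obtain z r where z: "orbit_limit S X act q y z" and r: "r \<in> ultrafilters_near S e"
    and zr: "orbit_limit S X act r z y" using return[OF q(1)] by blast
  have uq: "ultrafilter_on S q" and ur: "ultrafilter_on S r"
    using q(1) r by (auto simp: ultrafilters_near_iff)
  define N where "N = X interior_of W"
  have N: "openin X N" "y \<in> N" "N \<subseteq> W" using W by (auto simp: N_def nbhds_of_def interior_of_subset)
  have "{s\<in>S. act s z \<in> N} \<in> r" using zr N by (simp add: orbit_limit_iff[OF ur])
  then have "{s\<in>S. act s z \<in> N} \<inter> (S \<inter> U) \<in> r"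
    using ultrafilters_near_nbhd[OF r U] by (rule ultrafilter_onD(4)[OF ur])
  then have "{s\<in>S. act s z \<in> N} \<inter> (S \<inter> U) \<noteq> {}" using ultrafilter_onD(3)[OF ur] by metis
  then obtain s where s: "s \<in> S" "s \<in> U" "act s z \<in> N" by blast
  have "continuous_map X X (act s)" using D s(1) by (simp add: dynamical_system_def)
  then have "openin X {w\<in>topspace X. act s w \<in> N}"
    using N(1) by (intro openin_continuous_map_preimage)
  moreover have "z \<in> {w\<in>topspace X. act s w \<in> N}" using s(3) orbit_limit_in_topspace[OF z] by simp
  ultimately have "{t\<in>S. act t y \<in> {w\<in>topspace X. act s w \<in> N}} \<in> q"
    using z by (simp only: orbit_limit_iff[OF uq])
  moreover have "R {s} \<in> \<D>" unfolding \<D>_def by (rule imageI) (use s(1,2) in simp)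
  then have "R {s} \<in> q" using q(2) by (rule subsetD[rotated])
  ultimately have "{t\<in>S. act t y \<in> {w\<in>topspace X. act s w \<in> N}} \<inter> R {s} \<in> q"
    by (rule ultrafilter_onD(4)[OF uq])
  moreover have "{t\<in>S. act t y \<in> {w\<in>topspace X. act s w \<in> N}} \<inter> R {s} = {}"
    using D s(1) y N(3) dense_subsemigroup_plus[OF S]
    by (auto simp: R_def C_def translate_inv_def dynamical_system_def)
  ultimately show False using ultrafilter_onD(3)[OF uq] by simp
qed

section \<open>Dynamical characterization of centrality\<close>

text \<open>The ultrafilters along which \<open>x\<close> and \<open>y\<close> have a common limit form a left ideal \<open>J\<close>. In a minimal
  left ideal \<open>L \<subseteq> J\<close>, recurrence makes the closed subsemigroup of those \<open>p\<close> with \<open>T_p y = y\<close>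
  nonempty: for \<open>q \<in> L\<close>, some \<open>r\<close> carries \<open>T_q y\<close> back to \<open>y\<close>, and \<open>r + q \<in> L\<close>. An idempotent \<open>p\<close> in it
  satisfies \<open>T_p x = T_p y = y\<close>, so \<open>x\<close> visits \<open>U\<close> along a member of \<open>p\<close>.\<close>

lemma orbit_data_imp_central_near:
  assumes S: "dense_subsemigroup S" and e: "e + e = e"
    and D: "dynamical_system S X act" and x: "x \<in> topspace X" and y: "y \<in> topspace X"
    and U: "U \<in> nbhds_of X {y}"
    and prox: "proximal_near S e X act x y"
    and rec: "uniformly_recurrent_near S e X act y"
  shows "central_near S e {s\<in>S. act s x \<in> U}"
proof -
  interpret compact_right_topological_semigroup "near_topology S e" "uplus S"
    using compact_right_topological_semigroup_near[OF S e] .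
  note plus = dense_subsemigroup_plus[OF S]
  have uf: "ultrafilter_on S p" if "p \<in> ultrafilters_near S e" for p
    using that by (simp add: ultrafilters_near_iff)
  note limit_uplus = orbit_limit_uplus[OF D plus uf uf]
  define J where "J = {p \<in> ultrafilters_near S e. \<exists>z. orbit_limit S X act p x z \<and> orbit_limit S X act p y z}"
  have "left_ideal J"
    unfolding left_ideal_def
  proof (intro conjI ballI)
    show "J \<noteq> {}" using proximal_near_imp_common_limit[OF D x y prox] by (auto simp: J_def)
    show "J \<subseteq> topspace (near_topology S e)" by (auto simp: J_def)
    fix c p assume c: "c \<in> topspace (near_topology S e)" and "p \<in> J"
    then obtain z where p: "p \<in> ultrafilters_near S e"
      and z: "orbit_limit S X act p x z" "orbit_limit S X act p y z" by (auto simp: J_def)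
    have c': "c \<in> ultrafilters_near S e" using c by simp
    obtain l where l: "orbit_limit S X act c z l"
      using orbit_limit_exists[OF D uf[OF c'] orbit_limit_in_topspace[OF z(1)]] by blast
    have "orbit_limit S X act (uplus S c p) x l" "orbit_limit S X act (uplus S c p) y l"
      using limit_uplus[OF c' p x z(1) l] limit_uplus[OF c' p y z(2) l] .
    moreover have "uplus S c p \<in> ultrafilters_near S e" using closed c p by simp
    ultimately show "uplus S c p \<in> J" by (auto simp: J_def)
  qed
  then obtain L where L: "L \<subseteq> J" "minimal_left_ideal L"
    using left_ideal_contains_minimal by meson
  have lL: "left_ideal L" using L(2) by (simp add: minimal_left_ideal_def)
  have LN: "L \<subseteq> ultrafilters_near S e" using lL by (simp add: left_ideal_def)
  define A where "A = {p\<in>L. orbit_limit S X act p y y}"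
  have "\<exists>p\<in>A. uplus S p p = p"
  proof (rule closed_subsemigroup_has_idempotent)
    have "closedin (stone_cech_topology S) {p \<in> stone_cech S. orbit_limit S X act p y y}"
      by (rule closedin_orbit_limit[OF y])
    then have "closedin (near_topology S e)
        (ultrafilters_near S e \<inter> {p \<in> stone_cech S. orbit_limit S X act p y y})"
      unfolding near_topology_def by (rule closedin_subtopology_Int_closed)
    then have "closedin (near_topology S e)
        (L \<inter> (ultrafilters_near S e \<inter> {p \<in> stone_cech S. orbit_limit S X act p y y}))"
      by (rule closedin_Int[OF closedin_minimal_left_ideal[OF L(2)]])
    moreover have "L \<inter> (ultrafilters_near S e \<inter> {p \<in> stone_cech S. orbit_limit S X act p y y}) = A"
      using LN by (auto simp: A_def ultrafilters_near_def)
    ultimately show "closedin (near_topology S e) A" by simp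
    obtain q where q: "q \<in> L" "q \<in> ultrafilters_near S e" using lL by (auto simp: left_ideal_def)
    obtain z where z: "orbit_limit S X act q y z"
      using orbit_limit_exists[OF D uf[OF q(2)] y] by blast
    obtain r where r: "r \<in> ultrafilters_near S e" "orbit_limit S X act r z y"
      using uniformly_recurrent_near_imp_return[OF D plus y rec q(2) z] by blast
    have "uplus S r q \<in> L" using lL r(1) q(1) by (simp add: left_ideal_def)
    then have "uplus S r q \<in> A" using limit_uplus[OF r(1) q(2) y z r(2)] by (simp add: A_def)
    then show "A \<noteq> {}" by blast
    fix a b assume ab: "a \<in> A" "b \<in> A"
    then have "a \<in> ultrafilters_near S e" "b \<in> ultrafilters_near S e" using LN by (auto simp: A_def)
    then show "uplus S a b \<in> A"
      using ab lL limit_uplus[of a b y y y] y by (simp add: A_def left_ideal_def)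
  qed
  then obtain p where p: "p \<in> L" "orbit_limit S X act p y y" "uplus S p p = p" by (auto simp: A_def)
  have up: "ultrafilter_on S p" using p(1) LN uf by blast
  obtain z where "orbit_limit S X act p x z" "orbit_limit S X act p y z"
    using p(1) L(1) by (auto simp: J_def)
  then have px: "orbit_limit S X act p x y" using orbit_limit_unique[OF D up p(2)] by metis
  have "openin X (X interior_of U)" "y \<in> X interior_of U" using U by (auto simp: nbhds_of_def)
  then have "{s\<in>S. act s x \<in> X interior_of U} \<in> p" using px by (simp add: orbit_limit_iff[OF up])
  then have "{s\<in>S. act s x \<in> U} \<in> p"
    by (rule ultrafilter_onD(5)[OF up]) (use interior_of_subset in fastforce)+
  moreover have "p \<in> smallest_ideal (uplus S) (ultrafilters_near S e)"
    using smallest_ideal_eq_Union p(1) L(2) by auto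
  ultimately show ?thesis using p(3) by (auto simp: central_near_def)
qed

definition shift_space :: "('a option \<Rightarrow> bool) topology" where
  "shift_space = product_topology (\<lambda>_. discrete_topology UNIV) UNIV"

text \<open>The points are the indicator functions on the semigroup with an identity \<open>None\<close> adjoined, and
  \<open>shift s\<close> is composition with the right translation by \<open>s\<close>; on this side translations compose in
  the order that makes the shift an action.\<close>

definition shift :: "'a::plus \<Rightarrow> ('a option \<Rightarrow> bool) \<Rightarrow> 'a option \<Rightarrow> bool" where
  "shift s w = (\<lambda>i. w (Some (case i of None \<Rightarrow> s | Some t \<Rightarrow> t + s)))"

lemma topspace_shift_space [simp]: "topspace shift_space = UNIV"
  by (simp add: shift_space_def)

lemma dynamical_system_shift: "dynamical_system (S :: 'a::semigroup_add set) shift_space shift"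
  unfolding dynamical_system_def
proof (intro conjI ballI)
  show "compact_space (shift_space :: ('a option \<Rightarrow> bool) topology)"
    unfolding shift_space_def compact_space_product_topology
    by (intro disjI2 ballI) (simp add: compact_space_discrete_topology)
  show "Hausdorff_space (shift_space :: ('a option \<Rightarrow> bool) topology)"
    unfolding shift_space_def Hausdorff_space_product_topology
    by (intro disjI2 ballI Hausdorff_space_discrete_topology)
  show "continuous_map shift_space shift_space (shift s)" for s :: 'a
    unfolding shift_space_def continuous_map_componentwise_UNIV shift_def
    by (intro allI continuous_map_product_projection) simp
  show "shift s (shift t w) = shift (s + t) w" for s t :: 'a and w
    by (auto simp: shift_def add.assoc split: option.split)
qed

text \<open>For an idempotent \<open>p \<ni> B\<close> of the smallest ideal take for \<open>x\<close> the indicator function of \<open>B\<close>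
  and for \<open>y\<close> the limit \<open>T_p x\<close>. Idempotence gives \<open>T_p y = y = T_p x\<close>, hence proximality. For \<open>q\<close>
  near \<open>e\<close>, minimality provides \<open>r\<close> with \<open>r + q + p = p\<close>, so that \<open>T_r (T_q y) = y\<close>, hence uniform
  recurrence. The coordinate \<open>None\<close> plays the role of an identity adjoined to the semigroup, so the shift
  of \<open>x\<close> by \<open>s\<close> has the value \<open>x (Some s)\<close> there, and \<open>B\<close> is the set of times at which \<open>x\<close> visits the
  clopen set of points with value \<open>True\<close> at \<open>None\<close>.\<close>

lemma central_near_imp_orbit_data:
  fixes S :: "'a::semitopological_semigroup_add set"
  assumes S: "dense_subsemigroup S" and e: "e + e = e" and BS: "B \<subseteq> S" and B: "central_near S e B"
  shows "\<exists>x y U. U \<in> nbhds_of shift_space {y} \<and> proximal_near S e shift_space shift x y \<and>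
    uniformly_recurrent_near S e shift_space shift y \<and> B = {s\<in>S. shift s x \<in> U}"
proof -
  interpret compact_right_topological_semigroup "near_topology S e" "uplus S"
    using compact_right_topological_semigroup_near[OF S e] .
  note plus = dense_subsemigroup_plus[OF S]
  have uf: "ultrafilter_on S p" if "p \<in> ultrafilters_near S e" for p
    using that by (simp add: ultrafilters_near_iff)
  note D = dynamical_system_shift[of S]
  note limit_uplus = orbit_limit_uplus[OF D plus uf uf]
  obtain p where p: "p \<in> smallest_ideal (uplus S) (ultrafilters_near S e)" "uplus S p p = p" "B \<in> p"
    using B by (auto simp: central_near_def)
  then obtain L where L: "minimal_left_ideal L" "p \<in> L" using smallest_ideal_eq_Union by auto
  then have pN: "p \<in> ultrafilters_near S e" by (auto simp: minimal_left_ideal_def left_ideal_def)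
  define x where "x = (\<lambda>i. case i of None \<Rightarrow> False | Some s \<Rightarrow> s \<in> B)"
  obtain y where xy: "orbit_limit S shift_space shift p x y"
    using orbit_limit_exists[OF D uf[OF pN], of x] by auto
  obtain l where l: "orbit_limit S shift_space shift p y l"
    using orbit_limit_exists[OF D uf[OF pN], of y] by auto
  have "orbit_limit S shift_space shift p x l"
    using limit_uplus[OF pN pN _ xy l] p(2) by simp
  then have "l = y" using orbit_limit_unique[OF D uf[OF pN]] xy by blast
  then have yy: "orbit_limit S shift_space shift p y y" using l by simp
  define U where "U b = {w :: 'a option \<Rightarrow> bool. w None = b}" for b
  have openU: "openin shift_space (U b)" for b
  proof -
    have "continuous_map shift_space (discrete_topology UNIV) (\<lambda>w :: 'a option \<Rightarrow> bool. w None)"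
      unfolding shift_space_def by (rule continuous_map_product_projection) simp
    then have "openin shift_space {w \<in> topspace shift_space. (w :: 'a option \<Rightarrow> bool) None \<in> {b}}"
      by (rule openin_continuous_map_preimage) simp
    then show ?thesis by (simp add: U_def)
  qed
  have orbit: "{s\<in>S. shift s x \<in> U True} = B" "{s\<in>S. shift s x \<in> U False} = S - B"
    using BS by (auto simp: U_def shift_def x_def)
  have "y None"
  proof (rule ccontr)
    assume "\<not> y None"
    then have "y \<in> U False" by (simp add: U_def)
    then have "{s\<in>S. shift s x \<in> U False} \<in> p"
      using xy openU by (simp add: orbit_limit_iff[OF uf[OF pN]])
    then show False using orbit(2) ultrafilter_onD(6)[OF uf[OF pN] BS] p(3) by simp
  qed
  then have yU: "y \<in> U True" by (simp add: U_def)
  have "U True \<in> nbhds_of shift_space {y}"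
    using yU openU by (simp add: nbhds_of_def interior_of_openin)
  moreover have "proximal_near S e shift_space shift x y"
    using common_limit_imp_proximal_near[OF pN xy yy] .
  moreover have "uniformly_recurrent_near S e shift_space shift y"
  proof (rule return_imp_uniformly_recurrent_near[OF D S])
    fix q assume q: "q \<in> ultrafilters_near S e"
    obtain z where z: "orbit_limit S shift_space shift q y z"
      using orbit_limit_exists[OF D uf[OF q], of y] by auto
    \<comment> \<open>Since \<open>q + p\<close> lies in the minimal left ideal of \<open>p\<close>, some \<open>r\<close> brings it back to \<open>p\<close>.\<close>
    have qp: "uplus S q p \<in> L" "uplus S q p \<in> ultrafilters_near S e"
      using L q by (auto simp: minimal_left_ideal_def left_ideal_def)
    then have "p \<in> (\<lambda>a. uplus S a (uplus S q p)) ` topspace (near_topology S e)"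
      using minimal_left_ideal_eq_principal[OF L(1) qp(1)] L(2) by simp
    then obtain r where r: "r \<in> ultrafilters_near S e" "uplus S r (uplus S q p) = p" by auto
    obtain v where v: "orbit_limit S shift_space shift r z v"
      using orbit_limit_exists[OF D uf[OF r(1)], of z] by auto
    have "orbit_limit S shift_space shift (uplus S q p) y z"
      using limit_uplus[OF q pN _ yy z] by simp
    then have "orbit_limit S shift_space shift p y v"
      using limit_uplus[OF r(1) qp(2) _ _ v] r(2) by simp
    then have "v = y" using orbit_limit_unique[OF D uf[OF pN]] yy by blast
    then show "\<exists>z. orbit_limit S shift_space shift q y z \<and>
        (\<exists>r\<in>ultrafilters_near S e. orbit_limit S shift_space shift r z y)"
      using z v r(1) by blast
  qed simp
  ultimately show ?thesis using orbit(1) by blast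
qed

(* HOL cannot quantify over types inside a formula, so the existential over all compact Hausdorff
   spaces is split by direction. A space witnessing centrality is found on the fixed type
   'a option => bool (the full shift over the semigroup with a new identity adjoined), so the first
   conjunct is the equivalence for spaces on that type; the second conjunct gives the implication
   to centrality for spaces on an arbitrary type 'b. *)
theorem theorem2p13:
  fixes S B :: "'a::{semitopological_semigroup_add, t2_space} set"
    and e :: 'a
  assumes "dense_subsemigroup S"
    and "e + e = e"
    and "B \<subseteq> S"
  shows
    "(central_near S e B \<longleftrightarrow>
       (\<exists>(X :: ('a option \<Rightarrow> bool) topology) act x y U.
          dynamical_system S X act \<and> x \<in> topspace X \<and> y \<in> topspace X \<and>
          U \<in> nbhds_of X {y} \<and>
          proximal_near S e X act x y \<and>
          uniformly_recurrent_near S e X act y \<and>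
          B = {s\<in>S. act s x \<in> U})) \<and>
     ((\<exists>(X :: 'b topology) act x y U.
          dynamical_system S X act \<and> x \<in> topspace X \<and> y \<in> topspace X \<and>
          U \<in> nbhds_of X {y} \<and>
          proximal_near S e X act x y \<and>
          uniformly_recurrent_near S e X act y \<and>
          B = {s\<in>S. act s x \<in> U}) \<longrightarrow>
       central_near S e B)"
proof (intro conjI iffI impI)
  assume B: "central_near S e B"
  obtain x y :: "'a option \<Rightarrow> bool" and U where
    "U \<in> nbhds_of shift_space {y}" "proximal_near S e shift_space shift x y"
    "uniformly_recurrent_near S e shift_space shift y" "B = {s\<in>S. shift s x \<in> U}"
    using central_near_imp_orbit_data[OF assms B] by (elim exE conjE)
  then show "\<exists>(X :: ('a option \<Rightarrow> bool) topology) act x y U.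
      dynamical_system S X act \<and> x \<in> topspace X \<and> y \<in> topspace X \<and>
      U \<in> nbhds_of X {y} \<and> proximal_near S e X act x y \<and>
      uniformly_recurrent_near S e X act y \<and> B = {s\<in>S. act s x \<in> U}"
    using dynamical_system_shift[of S]
    by (intro exI[of _ shift_space] exI[of _ shift] exI[of _ x] exI[of _ y] exI[of _ U] conjI) simp_all
qed (elim exE conjE; simp add: orbit_data_imp_central_near[OF assms(1,2)])+

end
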